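(* Let $P\subseteq \mathrm{GL}(n,\mathbb{F}_q)$ be the standard parabolic subgroup of type $(n_1,\dots,n_s)$ with all block orders $n_k\le 2$. Then: 1) for any $x\in J$ there exists a rook placement $D$ in $\Delta_J$ such that $x$ is equivalent to $x_D$; 2) for rook placements $D,D'$ in $\Delta_J$, the elements $x_D$ and $x_{D'}$ are equivalent if and only if $D$ and $D'$ are conjugate with respect to the action of $W_R$ on $\Delta_J$.
   Context: $\mathbb{F}_q$ is a finite field, $n=n_1+\dots+n_s$, and $\{1,\dots,n\}$ is divided into consecutive segments $I_1,\dots,I_s$ of sizes $n_1,\dots,n_s$. The standard parabolic subgroup of type $(n_1,\dots,n_s)$ is the group $P$ of invertible block upper triangular matrices with diagonal blocks of sizes $n_1,\dots,n_s$. $P=RN$, where $R=R_1\times\dots\times R_s$, $R_k=\mathrm{GL}(n_k,\mathbb{F}_q)$, is the block-diagonal subgroup and $N=1+J$, with $J$ the algebra of strictly block upper triangular matrices. Put $\Delta_J=\bigcup_{1\le k<\ell\le s} I_k\times I_\ell$; its elements are called roots, and $\{E_\alpha:\alpha\in\Delta_J\}$ (matrix units) is a basis of $J$. The Weyl group $W_R=S_{I_1}\times\dots\times S_{I_s}$ of $R$ acts on $\Delta_J$ by $w(i,j)=(w(i),w(j))$. Elements $x,x'\in J$ are equivalent if there exist $r\in R$ and $a,b\in N$ such that $x'=raxbr^{-1}$. A rook placement is a subset $D\subseteq\Delta_J$ with at most one root in each row and at most one root in each column (the root $(i,j)$ lies in row $i$ and column $j$). Put $x_D=\sum_{\alpha\in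 D}E_\alpha$. *)

theory Defs
  imports "Jordan_Normal_Form.Matrix" "HOL-Combinatorics.Permutations"
begin

text \<open>
  A parabolic type is a list \<open>ns\<close> of block sizes, and \<open>n = sum_list ns\<close>. Matrix indices, and hence
  the segments of indices, start at 0: the segments partition \<open>{..<n}\<close>.
\<close>

definition segment :: "nat list \<Rightarrow> nat \<Rightarrow> nat set" where
  "segment ns k = {sum_list (take k ns) ..< sum_list (take (Suc k) ns)}"

definition roots :: "nat list \<Rightarrow> (nat \<times> nat) set" where
  "roots ns = (\<Union>l<length ns. \<Union>k<l. segment ns k \<times> segment ns l)"

text \<open>The subgroup \<open>R\<close>: block-diagonal matrices whose \<open>k\<close>-th diagonal block lies in \<open>GL(n\<^sub>k)\<close>.\<close>

definition levi_subgroup :: "nat list \<Rightarrow> 'a :: field mat set" where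
  "levi_subgroup ns =
     {diag_block_mat rs | rs. list_all2 (\<lambda>r m. r \<in> carrier_mat m m \<and> invertible_mat r) rs ns}"

text \<open>The algebra \<open>J\<close>: matrices vanishing outside the roots.\<close>

definition nil_radical :: "nat list \<Rightarrow> 'a :: field mat set" where
  "nil_radical ns =
     {x \<in> carrier_mat (sum_list ns) (sum_list ns).
        \<forall>i<sum_list ns. \<forall>j<sum_list ns. (i, j) \<notin> roots ns \<longrightarrow> x $$ (i, j) = 0}"

definition unipotent_radical :: "nat list \<Rightarrow> 'a :: field mat set" where
  "unipotent_radical ns = {1\<^sub>m (sum_list ns) + y | y. y \<in> nil_radical ns}"

text \<open>The matrix \<open>r'\<close> is \<open>r\<^sup>-\<^sup>1\<close>.\<close>

definition parabolic_equiv :: "nat list \<Rightarrow> 'a :: field mat \<Rightarrow> 'a mat \<Rightarrow> bool" where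
  "parabolic_equiv ns x x' \<longleftrightarrow>
     (\<exists>r \<in> levi_subgroup ns. \<exists>r' \<in> carrier_mat (sum_list ns) (sum_list ns).
      \<exists>a \<in> unipotent_radical ns. \<exists>b \<in> unipotent_radical ns.
        inverts_mat r r' \<and> inverts_mat r' r \<and> x' = r * a * x * b * r')"

definition rook_placement :: "nat list \<Rightarrow> (nat \<times> nat) set \<Rightarrow> bool" where
  "rook_placement ns D \<longleftrightarrow> D \<subseteq> roots ns \<and>
     (\<forall>i j j'. (i, j) \<in> D \<longrightarrow> (i, j') \<in> D \<longrightarrow> j = j') \<and>
     (\<forall>i i' j. (i, j) \<in> D \<longrightarrow> (i', j) \<in> D \<longrightarrow> i = i')"

definition matrix_unit :: "nat \<Rightarrow> nat \<times> nat \<Rightarrow> 'a :: field mat" where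
  "matrix_unit n \<alpha> = mat n n (\<lambda>p. if p = \<alpha> then 1 else 0)"

text \<open>
  Matrices of unspecified size do not form a \<open>comm_monoid_add\<close>, so the sum of the matrix units
  \<open>E\<^sub>\<alpha>\<close> over \<open>\<alpha> \<in> D\<close> is taken entrywise.
\<close>

definition rook_matrix :: "nat list \<Rightarrow> (nat \<times> nat) set \<Rightarrow> 'a :: field mat" where
  "rook_matrix ns D =
     mat (sum_list ns) (sum_list ns) (\<lambda>p. \<Sum>\<alpha>\<in>D. matrix_unit (sum_list ns) \<alpha> $$ p)"

text \<open>The product of the symmetric groups of the segments, inside the permutations of \<open>{..<n}\<close>.\<close>

definition weyl_group :: "nat list \<Rightarrow> (nat \<Rightarrow> nat) set" where
  "weyl_group ns =
     {w. w permutes {..<sum_list ns} \<and> (\<forall>k<length ns. w ` segment ns k = segment ns k)}"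

definition weyl_conjugate :: "nat list \<Rightarrow> (nat \<times> nat) set \<Rightarrow> (nat \<times> nat) set \<Rightarrow> bool" where
  "weyl_conjugate ns D D' \<longleftrightarrow> (\<exists>w \<in> weyl_group ns. D' = (\<lambda>(i, j). (w i, w j)) ` D)"

end

(*
  With g = r a and h = b r^-1, equivalence is x' = g x h for block upper triangular g, h whose
  diagonal blocks are mutually inverse: a row operation within a block forces the inverse operation
  on the columns of that block, operations between different blocks are free.

  Existence: reduce the columns from left to right, the columns treated so far forming a rook
  placement D. Entries in rows of D are cleared by column operations. Among the other nonzero rows
  of the next column take as pivot one whose chain of D, read backwards as a word of block numbers,
  is lexicographically largest; the side effects of clearing the other rows with it can be
  pushed back along the chains.

  Uniqueness: if g x_D = x_D' k with g and k having the same diagonal blocks, a nonzero diagonal block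
  entry g(i,j) forces the words of the chains through i and j to be comparable. Applied to g and its
  inverse, this makes the entries between positions of equal words an invertible matrix, so D and D'
  have equally many positions of every word.
*)
theory Submission
  imports Defs "Jordan_Normal_Form.Determinant" "HOL-Library.List_Lexorder"
begin

section \<open>Block numbers of indices\<close>

fun block_of :: "nat list \<Rightarrow> nat \<Rightarrow> nat" where
  "block_of [] i = 0"
| "block_of (m # ns) i = (if i < m then 0 else Suc (block_of ns (i - m)))"

text \<open>An index beyond \<open>sum_list ns\<close> receives the value \<open>length ns\<close>,
  so monotonicity needs no range condition.\<close>

lemma block_of_mono: "i \<le> j \<Longrightarrow> block_of ns i \<le> block_of ns j"
  by (induction ns arbitrary: i j) auto

lemma segment_Cons_0 [simp]: "segment (m # ns) 0 = {..<m}"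
  by (auto simp: segment_def)

lemma segment_Cons_Suc: "i \<in> segment (m # ns) (Suc k) \<longleftrightarrow> m \<le> i \<and> i - m \<in> segment ns k"
  by (auto simp: segment_def)

lemma segment_iff:
  "k < length ns \<Longrightarrow> i \<in> segment ns k \<longleftrightarrow> i < sum_list ns \<and> block_of ns i = k"
proof (induction ns arbitrary: i k)
  case (Cons m ns)
  show ?case
  proof (cases k)
    case (Suc k')
    then show ?thesis using Cons.IH[of k' "i - m"] Cons.prems
      by (auto simp: segment_Cons_Suc)
  qed auto
qed simp

lemma block_of_less: "i < sum_list ns \<Longrightarrow> block_of ns i < length ns"
  by (induction ns arbitrary: i) auto

lemma roots_iff:
  "(i, j) \<in> roots ns \<longleftrightarrow> i < sum_list ns \<and> j < sum_list ns \<and> block_of ns i < block_of ns j"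
  unfolding roots_def using block_of_less[of j ns] by (auto simp: segment_iff)

lemma root_less: "(i, j) \<in> roots ns \<Longrightarrow> i < j"
  using block_of_mono[of j i ns] by (force simp: roots_iff)

lemma index_mult_square:
  assumes "A \<in> carrier_mat n n" "B \<in> carrier_mat n n" "i < n" "j < n"
  shows "(A * B) $$ (i, j) = (\<Sum>l<n. A $$ (i, l) * B $$ (l, j))"
  using assms by (auto simp: scalar_prod_def lessThan_atLeast0 intro!: sum.cong)

section \<open>Block upper triangular matrices and their diagonal blocks\<close>

definition block_upper :: "nat list \<Rightarrow> 'a :: field mat \<Rightarrow> bool" where
  "block_upper ns A \<longleftrightarrow> A \<in> carrier_mat (sum_list ns) (sum_list ns) \<and>
     (\<forall>i<sum_list ns. \<forall>j<sum_list ns. block_of ns j < block_of ns i \<longrightarrow> A $$ (i, j) = 0)"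

text \<open>The equation \<open>diag_part ns r = r\<close> serves below to say that \<open>r\<close>
  is block diagonal of the right size.\<close>

definition diag_part :: "nat list \<Rightarrow> 'a :: field mat \<Rightarrow> 'a mat" where
  "diag_part ns A = mat (sum_list ns) (sum_list ns)
     (\<lambda>(i, j). if block_of ns i = block_of ns j then A $$ (i, j) else 0)"

lemma block_upper_carrier: "block_upper ns A \<Longrightarrow> A \<in> carrier_mat (sum_list ns) (sum_list ns)"
  by (simp add: block_upper_def)

lemma diag_part_carrier [simp]: "diag_part ns A \<in> carrier_mat (sum_list ns) (sum_list ns)"
  by (simp add: diag_part_def)

lemma diag_part_index [simp]:
  "i < sum_list ns \<Longrightarrow> j < sum_list ns \<Longrightarrow>
    diag_part ns A $$ (i, j) = (if block_of ns i = block_of ns j then A $$ (i, j) else 0)"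
  by (simp add: diag_part_def)

lemma block_upper_diag_part [simp]: "block_upper ns (diag_part ns A)"
  by (simp add: block_upper_def)

lemma diag_part_idem [simp]: "diag_part ns (diag_part ns A) = diag_part ns A"
  by (rule eq_matI) (auto simp: diag_part_def)

lemma diag_part_one [simp]: "diag_part ns (1\<^sub>m (sum_list ns)) = 1\<^sub>m (sum_list ns)"
  by (rule eq_matI) (auto simp: diag_part_def)

lemma block_upper_one [simp]: "block_upper ns (1\<^sub>m (sum_list ns))"
  by (auto simp: block_upper_def)

lemma block_upper_mult:
  assumes "block_upper ns A" "block_upper ns B"
  shows "block_upper ns (A * B)"
proof -
  have "A $$ (i, l) * B $$ (l, j) = 0"
    if "i < sum_list ns" "j < sum_list ns" "l < sum_list ns" "block_of ns j < block_of ns i" for i j l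
    using assms that unfolding block_upper_def
    by (metis less_trans linorder_neqE_nat mult_zero_left mult_zero_right)
  then show ?thesis
    using assms unfolding block_upper_def
    by (auto simp del: index_mult_mat(1) simp: index_mult_square[of A "sum_list ns"] intro!: sum.neutral)
qed

text \<open>For \<open>i\<close> and \<open>j\<close> in one block, only indices \<open>l\<close> of
  that block contribute to the entry of the product: \<open>A\<close> kills the smaller block
  numbers of \<open>l\<close> and \<open>B\<close> the larger ones.\<close>

lemma diag_part_mult:
  assumes "block_upper ns A" "block_upper ns B"
  shows "diag_part ns (A * B) = diag_part ns A * diag_part ns B"
proof (rule eq_matI)
  let ?n = "sum_list ns"
  note c = block_upper_carrier[OF assms(1)] block_upper_carrier[OF assms(2)]
  fix i j
  assume "i < dim_row (diag_part ns A * diag_part ns B)" "j < dim_col (diag_part ns A * diag_part ns B)"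
  then have ij: "i < ?n" "j < ?n" by (auto simp: diag_part_def)
  have eq: "diag_part ns A $$ (i, l) * diag_part ns B $$ (l, j) =
      (if block_of ns i = block_of ns j then A $$ (i, l) * B $$ (l, j) else 0)" if "l < ?n" for l
  proof -
    consider "block_of ns l < block_of ns i" | "block_of ns l = block_of ns i" | "block_of ns i < block_of ns l"
      by linarith
    then show ?thesis
      using assms ij that by cases (auto simp: block_upper_def)
  qed
  show "diag_part ns (A * B) $$ (i, j) = (diag_part ns A * diag_part ns B) $$ (i, j)"
  proof -
    have "(diag_part ns A * diag_part ns B) $$ (i, j) =
        (\<Sum>l<?n. diag_part ns A $$ (i, l) * diag_part ns B $$ (l, j))"
      by (rule index_mult_square) (use ij in auto)
    also have "\<dots> = (\<Sum>l<?n. if block_of ns i = block_of ns j then A $$ (i, l) * B $$ (l, j) else 0)"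
      by (rule sum.cong) (use eq in auto)
    also have "\<dots> = diag_part ns (A * B) $$ (i, j)"
      using index_mult_square[OF c ij] ij by simp
    finally show ?thesis by simp
  qed
qed (use assms in \<open>auto simp: diag_part_def block_upper_def\<close>)

section \<open>The unipotent radical, the Levi subgroup and their inverses\<close>

text \<open>On block upper triangular matrices the kernel of \<open>diag_part\<close> is J, so N = 1
  + J is the fibre over the identity.\<close>

lemma unipotent_radical_iff:
  "a \<in> unipotent_radical ns \<longleftrightarrow> block_upper ns a \<and> diag_part ns a = 1\<^sub>m (sum_list ns)"
proof
  let ?n = "sum_list ns"
  assume "a \<in> unipotent_radical ns"
  then obtain y where y: "a = 1\<^sub>m ?n + y" "y \<in> nil_radical ns" by (auto simp: unipotent_radical_def)
  have c: "y \<in> carrier_mat ?n ?n" using y by (simp add: nil_radical_def)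
  have z: "y $$ (i, j) = 0" if "i < ?n" "j < ?n" "block_of ns j \<le> block_of ns i" for i j
    using y(2) that by (auto simp: nil_radical_def roots_iff)
  show "block_upper ns a \<and> diag_part ns a = 1\<^sub>m ?n"
    unfolding y(1) block_upper_def using c z
    by (auto intro!: eq_matI simp: diag_part_def)
next
  let ?n = "sum_list ns"
  assume a: "block_upper ns a \<and> diag_part ns a = 1\<^sub>m ?n"
  have e: "a $$ (i, j) = (if i = j then 1 else 0)" if "i < ?n" "j < ?n" "block_of ns i = block_of ns j" for i j
    using arg_cong[OF conjunct2[OF a], of "\<lambda>m. m $$ (i, j)"] that by simp
  have "a = 1\<^sub>m ?n + (a - 1\<^sub>m ?n)"
    using a by (auto intro!: eq_matI simp: block_upper_def)
  moreover have "a - 1\<^sub>m ?n \<in> nil_radical ns"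
    using a e unfolding nil_radical_def block_upper_def
    by (auto simp: roots_iff linorder_not_less le_less)
  ultimately show "a \<in> unipotent_radical ns" unfolding unipotent_radical_def by blast
qed

text \<open>The inverse is assembled from that of the first block and that of the rest. Together
  with \<open>levi_subgroupI\<close> this replaces lists of blocks by block-diagonal matrices that
  have a block-diagonal inverse.\<close>

lemma levi_subgroup_inverse:
  assumes "r \<in> (levi_subgroup ns :: 'a :: field mat set)"
  shows "\<exists>r'. diag_part ns r = r \<and> diag_part ns r' = r' \<and>
    r * r' = 1\<^sub>m (sum_list ns) \<and> r' * r = 1\<^sub>m (sum_list ns)"
proof -
  have "\<exists>r'. diag_part ns (diag_block_mat rs) = diag_block_mat rs \<and> diag_part ns r' = r' \<and>
      diag_block_mat rs * r' = 1\<^sub>m (sum_list ns) \<and> r' * diag_block_mat rs = 1\<^sub>m (sum_list ns)"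
    if "list_all2 (\<lambda>r m. r \<in> carrier_mat m m \<and> invertible_mat r) rs ns" for rs :: "'a mat list"
    using that
  proof (induction rs ns rule: list_all2_induct)
    case Nil
    have "diag_part [] (0\<^sub>m 0 0 :: 'a mat) = 0\<^sub>m 0 0" by (auto simp: diag_part_def)
    then show ?case by (intro exI[of _ "0\<^sub>m 0 0"]) (auto simp: one_mat_def intro!: eq_matI)
  next
    case (Cons r rs m ns)
    let ?n = "sum_list ns" and ?R = "diag_block_mat rs"
    from Cons obtain r' where r': "diag_part ns ?R = ?R" "diag_part ns r' = r'"
      "?R * r' = 1\<^sub>m ?n" "r' * ?R = 1\<^sub>m ?n" by blast
    have c: "r \<in> carrier_mat m m" "?R \<in> carrier_mat ?n ?n" "r' \<in> carrier_mat ?n ?n"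
      using Cons diag_part_carrier[of ns ?R] diag_part_carrier[of ns r'] unfolding r' by auto
    obtain s where "inverts_mat r s" "inverts_mat s r"
      using Cons by (auto simp: invertible_mat_def)
    \<comment> \<open>\<open>invertible_mat\<close> leaves the size of \<open>s\<close> open; the
      dimensions of the two products force it to be \<open>m\<close> by \<open>m\<close>.\<close>
    with c have s: "r * s = 1\<^sub>m m" "s * r = 1\<^sub>m m" "s \<in> carrier_mat m m"
      unfolding inverts_mat_def
      by (metis carrier_matD carrier_matI index_mult_mat(3) index_one_mat(3))+
    let ?S = "four_block_mat s (0\<^sub>m m ?n) (0\<^sub>m ?n m) r'"
    have D: "diag_block_mat (r # rs) = four_block_mat r (0\<^sub>m m ?n) (0\<^sub>m ?n m) ?R"
      using c by (auto simp: Let_def)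
    have dp: "diag_part (m # ns) (four_block_mat A (0\<^sub>m m ?n) (0\<^sub>m ?n m) B) =
        four_block_mat A (0\<^sub>m m ?n) (0\<^sub>m ?n m) B"
      if "A \<in> carrier_mat m m" "B \<in> carrier_mat ?n ?n" "diag_part ns B = B" for A B :: "'a mat"
    proof (rule eq_matI)
      have B: "B $$ (i, j) = 0" if "i < ?n" "j < ?n" "block_of ns i \<noteq> block_of ns j" for i j
        using that diag_part_index[of i ns j B] unfolding \<open>diag_part ns B = B\<close> by simp
      fix i j assume "i < dim_row (four_block_mat A (0\<^sub>m m ?n) (0\<^sub>m ?n m) B)"
        "j < dim_col (four_block_mat A (0\<^sub>m m ?n) (0\<^sub>m ?n m) B)"
      then have "i < m + ?n" "j < m + ?n" using that by auto
      then show "diag_part (m # ns) (four_block_mat A (0\<^sub>m m ?n) (0\<^sub>m ?n m) B) $$ (i, j) =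
          four_block_mat A (0\<^sub>m m ?n) (0\<^sub>m ?n m) B $$ (i, j)"
        using that B[of "i - m" "j - m"] by (auto simp: diag_part_def)
    qed (use that in \<open>auto simp: diag_part_def\<close>)
    show ?case unfolding D
      using dp[OF c(1,2) r'(1)] dp[OF s(3) c(3) r'(2)] c s r'
      by (intro exI[of _ ?S])
        (auto simp: mult_four_block_mat[of _ m m _ ?n _ ?n _ _ m _ ?n])
  qed
  then show ?thesis using assms unfolding levi_subgroup_def by auto
qed

text \<open>Block-diagonal matrices multiply corner by corner, so the corners cut out of
  \<open>r\<close> and \<open>r'\<close> are mutually inverse; induction treats the lower
  one.\<close>

lemma levi_subgroupI:
  assumes "diag_part ns r = r" "diag_part ns r' = r'"
    "r * r' = 1\<^sub>m (sum_list ns)" "r' * r = 1\<^sub>m (sum_list ns)"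
  shows "r \<in> (levi_subgroup ns :: 'a :: field mat set)"
  using assms
proof (induction ns arbitrary: r r')
  case Nil
  have "r = diag_block_mat []" using diag_part_carrier[of "[]" r] Nil by (auto intro!: eq_matI)
  then show ?case unfolding levi_subgroup_def by (intro CollectI exI[of _ "[]"]) simp
next
  case (Cons m ns)
  let ?n = "sum_list ns"
  let ?TL = "\<lambda>A :: 'a mat. mat m m (\<lambda>(i, j). A $$ (i, j))"
  let ?BR = "\<lambda>A :: 'a mat. mat ?n ?n (\<lambda>(i, j). A $$ (m + i, m + j))"
  have split: "A = four_block_mat (?TL A) (0\<^sub>m m ?n) (0\<^sub>m ?n m) (?BR A)"
    if "diag_part (m # ns) A = A" for A :: "'a mat"
  proof (rule eq_matI)
    have c: "A \<in> carrier_mat (m + ?n) (m + ?n)" using diag_part_carrier[of "m # ns" A] that by simp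
    fix i j assume "i < dim_row (four_block_mat (?TL A) (0\<^sub>m m ?n) (0\<^sub>m ?n m) (?BR A))"
      "j < dim_col (four_block_mat (?TL A) (0\<^sub>m m ?n) (0\<^sub>m ?n m) (?BR A))"
    then have "i < m + ?n" "j < m + ?n" by auto
    then show "A $$ (i, j) = four_block_mat (?TL A) (0\<^sub>m m ?n) (0\<^sub>m ?n m) (?BR A) $$ (i, j)"
      using diag_part_index[of i "m # ns" j A] unfolding that by auto
  qed (use diag_part_carrier[of "m # ns" A] that in auto)
  have dpBR: "diag_part ns (?BR A) = ?BR A" if "diag_part (m # ns) A = A" for A :: "'a mat"
  proof (rule eq_matI)
    fix i j assume "i < dim_row (?BR A)" "j < dim_col (?BR A)"
    then show "diag_part ns (?BR A) $$ (i, j) = ?BR A $$ (i, j)"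
      using diag_part_index[of "m + i" "m # ns" "m + j" A] unfolding that by (auto simp: diag_part_def)
  qed (auto simp: diag_part_def)
  have prod: "?TL A * ?TL B = 1\<^sub>m m \<and> ?BR A * ?BR B = 1\<^sub>m ?n"
    if "A = four_block_mat (?TL A) (0\<^sub>m m ?n) (0\<^sub>m ?n m) (?BR A)"
      "B = four_block_mat (?TL B) (0\<^sub>m m ?n) (0\<^sub>m ?n m) (?BR B)" "A * B = 1\<^sub>m (m + ?n)" for A B
  proof -
    have "A * B = four_block_mat (?TL A * ?TL B) (0\<^sub>m m ?n) (0\<^sub>m ?n m) (?BR A * ?BR B)"
      by (subst that(1), subst that(2), subst mult_four_block_mat[of _ m m _ ?n _ ?n _ _ m _ ?n]) auto
    then have e: "four_block_mat (?TL A * ?TL B) (0\<^sub>m m ?n) (0\<^sub>m ?n m) (?BR A * ?BR B) $$ (i, j) =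
        1\<^sub>m (m + ?n) $$ (i, j)" for i j using that(3) by simp
    have "?TL A * ?TL B = 1\<^sub>m m"
    proof (rule eq_matI)
      fix i j assume "i < dim_row (1\<^sub>m m :: 'a mat)" "j < dim_col (1\<^sub>m m :: 'a mat)"
      then show "(?TL A * ?TL B) $$ (i, j) = 1\<^sub>m m $$ (i, j)"
        using e[of i j] by (simp add: index_mat_four_block del: index_mult_mat(1))
    qed auto
    moreover have "?BR A * ?BR B = 1\<^sub>m ?n"
    proof (rule eq_matI)
      fix i j assume "i < dim_row (1\<^sub>m ?n :: 'a mat)" "j < dim_col (1\<^sub>m ?n :: 'a mat)"
      then show "(?BR A * ?BR B) $$ (i, j) = 1\<^sub>m ?n $$ (i, j)"
        using e[of "m + i" "m + j"] by (simp add: index_mat_four_block del: index_mult_mat(1))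
    qed auto
    ultimately show ?thesis by blast
  qed
  note sr = split[OF Cons.prems(1)] split[OF Cons.prems(2)]
  have p: "?TL r * ?TL r' = 1\<^sub>m m" "?BR r * ?BR r' = 1\<^sub>m ?n" "?TL r' * ?TL r = 1\<^sub>m m" "?BR r' * ?BR r = 1\<^sub>m ?n"
    using prod[OF sr] prod[OF sr(2,1)] Cons.prems by simp_all
  have "?BR r \<in> levi_subgroup ns"
    by (rule Cons.IH[OF dpBR dpBR]) (use Cons.prems p in auto)
  then obtain rs where rs: "?BR r = diag_block_mat rs"
    "list_all2 (\<lambda>r m. r \<in> carrier_mat m m \<and> invertible_mat r) rs ns"
    unfolding levi_subgroup_def by blast
  have "invertible_mat (?TL r)" unfolding invertible_mat_def inverts_mat_def
    using p by (auto intro!: exI[of _ "?TL r'"])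
  moreover have "dim_row (diag_block_mat rs) = ?n" "dim_col (diag_block_mat rs) = ?n"
    unfolding rs(1)[symmetric] by auto
  then have "r = diag_block_mat (?TL r # rs)"
    by (subst sr(1)) (simp add: rs(1) Let_def)
  ultimately show ?case unfolding levi_subgroup_def using rs(2)
    by (intro CollectI exI[of _ "?TL r # rs"]) auto
qed

text \<open>Such a \<open>b\<close> is upper triangular with ones on the diagonal, so its
  determinant is 1 and an inverse exists; back substitution gives the inverse the same
  shape.\<close>

lemma unipotent_inverse:
  assumes "block_upper ns b" "diag_part ns b = 1\<^sub>m (sum_list ns)"
  shows "\<exists>c. block_upper ns c \<and> diag_part ns c = 1\<^sub>m (sum_list ns) \<and>
    b * c = 1\<^sub>m (sum_list ns) \<and> c * b = 1\<^sub>m (sum_list ns)"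
proof -
  let ?n = "sum_list ns"
  note bc = block_upper_carrier[OF assms(1)]
  have b: "b $$ (i, j) = (if i = j then 1 else 0)"
    if "i < ?n" "j < ?n" "block_of ns j \<le> block_of ns i" for i j
    using that assms(1) diag_part_index[of i ns j b] unfolding assms(2) block_upper_def
    by (cases "block_of ns i = block_of ns j") auto
  have "upper_triangular b"
    using bc b block_of_mono by (intro upper_triangularI) (auto simp: less_imp_le)
  then have "det b = prod_list (diag_mat b)" using bc by (rule det_upper_triangular)
  also have "diag_mat b = map (\<lambda>_. 1) [0..<?n]"
    using bc b unfolding diag_mat_def by (intro map_cong) auto
  also have "prod_list \<dots> = 1" by (simp add: map_replicate_const)
  finally have "b \<in> Units (ring_mat TYPE('a) ?n ())"
    using bc by (intro det_non_zero_imp_unit) auto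
  then obtain c where c: "c \<in> carrier_mat ?n ?n" "b * c = 1\<^sub>m ?n" "c * b = 1\<^sub>m ?n"
    unfolding Units_def by (auto simp: ring_mat_simps)
  have cij: "c $$ (i, j) = (if i = j then 1 else 0)"
    if "i < ?n" "j < ?n" "block_of ns j \<le> block_of ns i" for i j
    using that
  \<comment> \<open>Rows are treated from the bottom up. In row \<open>i\<close> of
    \<open>b * c\<close> the indices of larger blocks contribute nothing by induction, and on all
    other indices row \<open>i\<close> of \<open>b\<close> is that of the identity.\<close>
  proof (induction "?n - i" arbitrary: i rule: less_induct)
    case less
    have "b $$ (i, l) * c $$ (l, j) = (if l = i then c $$ (i, j) else 0)" if "l < ?n" for l
    proof (cases "block_of ns l \<le> block_of ns i")
      case True
      then show ?thesis using b[of i l] that less by auto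
    next
      case False
      then have "i < l" using block_of_mono[of l i ns] by (meson linorder_not_less)
      then have "c $$ (l, j) = 0" using less.hyps[of l] less.prems that False by auto
      then show ?thesis using \<open>i < l\<close> by simp
    qed
    then have "(\<Sum>l<?n. b $$ (i, l) * c $$ (l, j)) = c $$ (i, j)"
      using less.prems by simp
    then show ?case using index_mult_square[OF bc c(1), of i j] less.prems c(2) by simp
  qed
  have "block_upper ns c" unfolding block_upper_def using c cij by auto
  moreover have "diag_part ns c = 1\<^sub>m ?n"
    using cij by (intro eq_matI) (auto simp: diag_part_def)
  ultimately show ?thesis using c by blast
qed

section \<open>Equivalence in terms of linked pairs\<close>

text \<open>
  Writing \<open>g = r a\<close> and \<open>h = b r\<^sup>-\<^sup>1\<close>, equivalence means \<open>x' = g x h\<close> for block upper triangular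
  matrices \<open>g\<close>, \<open>h\<close> whose diagonal blocks are inverse to each other.
\<close>

definition linked :: "nat list \<Rightarrow> 'a :: field mat \<Rightarrow> 'a mat \<Rightarrow> bool" where
  "linked ns g h \<longleftrightarrow> block_upper ns g \<and> block_upper ns h \<and>
     diag_part ns g * diag_part ns h = 1\<^sub>m (sum_list ns) \<and>
     diag_part ns h * diag_part ns g = 1\<^sub>m (sum_list ns)"

lemma linked_carrier:
  assumes "linked ns g h"
  shows "g \<in> carrier_mat (sum_list ns) (sum_list ns)" "h \<in> carrier_mat (sum_list ns) (sum_list ns)"
  using assms by (auto simp: linked_def block_upper_def)

lemma linked_sym: "linked ns g h \<Longrightarrow> linked ns h g"
  by (auto simp: linked_def)

text \<open>The product \<open>h * diag_part ns g\<close> is unipotent, so its inverse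
  \<open>c\<close> is too, and \<open>diag_part ns g * c\<close> inverts \<open>h\<close>. Hence
  \<open>h\<close> can be moved to the other side of \<open>x' = g * x * h\<close> with control over
  its diagonal blocks.\<close>

lemma linked_inverse:
  assumes "linked ns g h"
  shows "\<exists>k. block_upper ns k \<and> diag_part ns k = diag_part ns g \<and>
    h * k = 1\<^sub>m (sum_list ns) \<and> k * h = 1\<^sub>m (sum_list ns)"
proof -
  let ?n = "sum_list ns"
  have h: "block_upper ns h" using assms by (simp add: linked_def)
  have "block_upper ns (h * diag_part ns g)" "diag_part ns (h * diag_part ns g) = 1\<^sub>m ?n"
    using assms by (auto simp: linked_def diag_part_mult block_upper_mult)
  from unipotent_inverse[OF this] obtain c where c: "block_upper ns c" "diag_part ns c = 1\<^sub>m ?n"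
    "h * diag_part ns g * c = 1\<^sub>m ?n" by blast
  let ?k = "diag_part ns g * c"
  have k: "block_upper ns ?k" "diag_part ns ?k = diag_part ns g"
    using c by (auto simp: block_upper_mult diag_part_mult right_mult_one_mat[OF diag_part_carrier])
  have "h * ?k = 1\<^sub>m ?n"
    using c(3) assoc_mult_mat[OF block_upper_carrier[OF h] diag_part_carrier block_upper_carrier[OF c(1)]]
    by simp
  moreover from this have "?k * h = 1\<^sub>m ?n"
    by (rule mat_mult_left_right_inverse[OF block_upper_carrier[OF h] block_upper_carrier[OF k(1)]])
  ultimately show ?thesis using k by blast
qed

lemma parabolic_equiv_iff:
  assumes x: "x \<in> carrier_mat (sum_list ns) (sum_list ns)"
  shows "parabolic_equiv ns x x' \<longleftrightarrow> (\<exists>g h. linked ns g h \<and> x' = g * x * h)"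
proof
  let ?n = "sum_list ns"
  assume "parabolic_equiv ns x x'"
  then obtain r r' a b where *: "r \<in> levi_subgroup ns" "r' \<in> carrier_mat ?n ?n"
    "a \<in> unipotent_radical ns" "b \<in> unipotent_radical ns"
    "inverts_mat r r'" "inverts_mat r' r" "x' = r * a * x * b * r'"
    unfolding parabolic_equiv_def by blast
  obtain s where s: "diag_part ns r = r" "diag_part ns s = s" "r * s = 1\<^sub>m ?n" "s * r = 1\<^sub>m ?n"
    using levi_subgroup_inverse[OF *(1)] by blast
  have rc: "r \<in> carrier_mat ?n ?n" "s \<in> carrier_mat ?n ?n"
    using diag_part_carrier[of ns r] diag_part_carrier[of ns s] unfolding s by auto
  \<comment> \<open>Nothing is known about the shape of \<open>r'\<close>; uniqueness of inverses
    identifies it with the block-diagonal \<open>s\<close>.\<close>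
  have "r * r' = 1\<^sub>m ?n" using *(5) rc by (simp add: inverts_mat_def)
  then have "s * (r * r') = s" using rc by simp
  moreover have "s * (r * r') = r'" using assoc_mult_mat[OF rc(2,1) *(2)] s(4) *(2) by simp
  ultimately have r': "r' = s" by simp
  have bu: "block_upper ns r" "block_upper ns s"
    using block_upper_diag_part[of ns r] block_upper_diag_part[of ns s] unfolding s by auto
  note U = *(3,4)[unfolded unipotent_radical_iff]
  have c: "a \<in> carrier_mat ?n ?n" "b \<in> carrier_mat ?n ?n" using U by (auto simp: block_upper_carrier)
  have "linked ns (r * a) (b * s)"
    unfolding linked_def using U bu s rc
    by (auto simp: block_upper_mult diag_part_mult)
  moreover have "x' = r * a * x * (b * s)"
    unfolding *(7) r' using rc c x by (intro assoc_mult_mat[of _ ?n ?n _ ?n]) auto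
  ultimately show "\<exists>g h. linked ns g h \<and> x' = g * x * h" by blast
next
  let ?n = "sum_list ns"
  assume "\<exists>g h. linked ns g h \<and> x' = g * x * h"
  then obtain g h where gh: "linked ns g h" "x' = g * x * h" by blast
  note c = linked_carrier[OF gh(1)]
  \<comment> \<open>The Levi factor is recovered as the diagonal part of \<open>g\<close>, with
    inverse \<open>?s\<close>; the unipotent factors are then \<open>?s * g\<close> and
    \<open>h * ?r\<close>.\<close>
  let ?r = "diag_part ns g" and ?s = "diag_part ns h"
  note rs = gh(1)[unfolded linked_def]
  have rc: "?r \<in> carrier_mat ?n ?n" "?s \<in> carrier_mat ?n ?n" by auto
  have 1: "?r \<in> levi_subgroup ns" by (rule levi_subgroupI[of _ _ ?s]) (use rs in auto)
  have 2: "?s * g \<in> unipotent_radical ns" "h * ?r \<in> unipotent_radical ns"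
    unfolding unipotent_radical_iff using rs by (auto simp: block_upper_mult diag_part_mult)
  have 3: "inverts_mat ?r ?s" "inverts_mat ?s ?r"
    using rs rc unfolding inverts_mat_def by (auto simp: diag_part_def)
  have "?r * (?s * g) = g"
    using assoc_mult_mat[OF rc c(1)] rs c by simp
  moreover have "h * ?r * ?s = h"
    using assoc_mult_mat[OF c(2) rc] rs c by simp
  moreover have "g * x * (h * ?r) * ?s = g * x * (h * ?r * ?s)"
    using c x by (intro assoc_mult_mat[of _ ?n ?n _ ?n _ ?n]) auto
  ultimately have "x' = ?r * (?s * g) * x * (h * ?r) * ?s" using gh(2) by simp
  then show "parabolic_equiv ns x x'"
    unfolding parabolic_equiv_def using 1 2 3 rc by blast
qed

lemma linked_one: "linked ns (1\<^sub>m (sum_list ns)) (1\<^sub>m (sum_list ns))"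
  by (simp add: linked_def)

lemma linked_mult:
  assumes "linked ns g h" "linked ns g' h'"
  shows "linked ns (g' * g) (h * h')"
proof -
  let ?n = "sum_list ns"
  have inv: "(C * A) * (B * E) = 1\<^sub>m ?n"
    if "A * B = 1\<^sub>m ?n" "C * E = 1\<^sub>m ?n" "A \<in> carrier_mat ?n ?n" "B \<in> carrier_mat ?n ?n"
      "C \<in> carrier_mat ?n ?n" "E \<in> carrier_mat ?n ?n" for A B C E :: "'a mat"
  proof -
    have "(C * A) * (B * E) = C * (A * (B * E))" using that by (intro assoc_mult_mat) auto
    also have "A * (B * E) = A * B * E" using that by (intro assoc_mult_mat[symmetric]) auto
    finally show ?thesis using that by simp
  qed
  show ?thesis using assms unfolding linked_def
    by (auto simp: block_upper_mult diag_part_mult intro!: inv)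
qed

lemma parabolic_equiv_refl:
  assumes "x \<in> carrier_mat (sum_list ns) (sum_list ns)"
  shows "parabolic_equiv ns x x"
  unfolding parabolic_equiv_iff[OF assms]
  using linked_one assms by (intro exI[of _ "1\<^sub>m (sum_list ns)"]) auto

lemma parabolic_equiv_trans:
  assumes "x \<in> carrier_mat (sum_list ns) (sum_list ns)"
    "parabolic_equiv ns x y" "parabolic_equiv ns y z"
  shows "parabolic_equiv ns x z"
proof -
  let ?n = "sum_list ns"
  obtain g h where gh: "linked ns g h" "y = g * x * h"
    using assms by (auto simp: parabolic_equiv_iff)
  note c = linked_carrier[OF gh(1)]
  have "y \<in> carrier_mat ?n ?n" using c assms gh(2) by auto
  then obtain g' h' where gh': "linked ns g' h'" "z = g' * y * h'"
    using assms(3) by (auto simp: parabolic_equiv_iff)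
  note c' = linked_carrier[OF gh'(1)]
  have "g' * (g * x * h) = g' * (g * x) * h"
    using c c' assms(1) by (intro assoc_mult_mat[symmetric]) auto
  also have "g' * (g * x) = g' * g * x"
    using c c' assms(1) by (intro assoc_mult_mat[symmetric]) auto
  finally have "z = g' * g * x * h * h'" using gh(2) gh'(2) by simp
  also have "\<dots> = g' * g * x * (h * h')"
    using c c' assms(1) by (intro assoc_mult_mat) auto
  finally show ?thesis
    unfolding parabolic_equiv_iff[OF assms(1)] using linked_mult[OF gh(1) gh'(1)] by blast
qed

lemma nil_radical_carrier: "x \<in> nil_radical ns \<Longrightarrow> x \<in> carrier_mat (sum_list ns) (sum_list ns)"
  by (simp add: nil_radical_def)

lemma nil_radical_zero:
  "x \<in> nil_radical ns \<Longrightarrow> i < sum_list ns \<Longrightarrow> j < sum_list ns \<Longrightarrow>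
    block_of ns j \<le> block_of ns i \<Longrightarrow> x $$ (i, j) = 0"
  by (auto simp: nil_radical_def roots_iff)

text \<open>J is a two-sided ideal in the algebra of block upper triangular matrices.\<close>

lemma nil_radical_parabolic_equiv:
  assumes x: "x \<in> nil_radical ns" and "parabolic_equiv ns x y"
  shows "y \<in> nil_radical ns"
proof -
  let ?n = "sum_list ns"
  note xc = nil_radical_carrier[OF x]
  obtain g h where gh: "linked ns g h" "y = g * x * h"
    using assms(2) by (auto simp: parabolic_equiv_iff[OF xc])
  note c = linked_carrier[OF gh(1)]
  have bu: "block_upper ns g" "block_upper ns h" using gh by (auto simp: linked_def)
  have 1: "(g * x) $$ (i, j) = 0"
    if "i < ?n" "j < ?n" "block_of ns j \<le> block_of ns i" for i j
  proof -
    have "g $$ (i, l) * x $$ (l, j) = 0" if "l < ?n" for l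
      using bu(1) nil_radical_zero[OF x, of l j] that \<open>i < ?n\<close> \<open>j < ?n\<close> \<open>block_of ns j \<le> block_of ns i\<close>
      unfolding block_upper_def by (cases "block_of ns l < block_of ns i") auto
    then show ?thesis using that
      by (simp add: index_mult_square[OF c(1) xc] del: index_mult_mat(1)) (rule sum.neutral, auto)
  qed
  have "y $$ (i, j) = 0"
    if "i < ?n" "j < ?n" "block_of ns j \<le> block_of ns i" for i j
  proof -
    have "(g * x) $$ (i, l) * h $$ (l, j) = 0" if "l < ?n" for l
      using bu(2) 1[of i l] that \<open>i < ?n\<close> \<open>j < ?n\<close> \<open>block_of ns j \<le> block_of ns i\<close>
      unfolding block_upper_def by (cases "block_of ns j < block_of ns l") (auto simp del: index_mult_mat(1))
    moreover have "y $$ (i, j) = (\<Sum>l<?n. (g * x) $$ (i, l) * h $$ (l, j))"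
      unfolding gh(2) by (rule index_mult_square) (use c xc that in auto)
    ultimately show ?thesis by (auto simp del: index_mult_mat(1) intro!: sum.neutral)
  qed
  then show ?thesis unfolding nil_radical_def using gh(2) c xc
    by (auto simp: roots_iff linorder_not_less)
qed

section \<open>Rook matrices\<close>

lemma rook_placement_finite: "rook_placement ns D \<Longrightarrow> finite D"
proof (rule finite_subset)
  assume "rook_placement ns D"
  then show "D \<subseteq> {..<sum_list ns} \<times> {..<sum_list ns}"
    by (auto simp: rook_placement_def roots_iff dest!: subsetD)
qed simp

lemma rook_matrix_carrier [simp]:
  "rook_matrix ns D \<in> carrier_mat (sum_list ns) (sum_list ns)"
  by (simp add: rook_matrix_def)

lemma dim_rook_matrix [simp]:
  "dim_row (rook_matrix ns D) = sum_list ns" "dim_col (rook_matrix ns D) = sum_list ns"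
  by (simp_all add: rook_matrix_def)

lemma rook_matrix_index:
  assumes "rook_placement ns D" "i < sum_list ns" "j < sum_list ns"
  shows "rook_matrix ns D $$ (i, j) = (if (i, j) \<in> D then 1 else 0)"
proof -
  have "rook_matrix ns D $$ (i, j) = (\<Sum>\<alpha>\<in>D. if (i, j) = \<alpha> then 1 else 0)"
    using assms by (simp add: rook_matrix_def matrix_unit_def)
  then show ?thesis using rook_placement_finite[OF assms(1)] by simp
qed

section \<open>Elementary row and column operations as equivalences\<close>

lemma diag_part_addrow_mat:
  assumes "a \<noteq> b" "a < sum_list ns" "b < sum_list ns"
  shows "diag_part ns (addrow_mat (sum_list ns) t a b) =
    (if block_of ns a = block_of ns b then addrow_mat (sum_list ns) t a b else 1\<^sub>m (sum_list ns))"
  using assms by (auto intro!: eq_matI simp: diag_part_def)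

lemma block_upper_addrow_mat:
  assumes "a < sum_list ns" "b < sum_list ns" "block_of ns a \<le> block_of ns b"
  shows "block_upper ns (addrow_mat (sum_list ns) t a b)"
  using assms by (auto simp: block_upper_def)

text \<open>Between different blocks the elementary matrix lies in N and may act on one side alone;
  inside a block it lies in R and its inverse has to act on the other side.\<close>

lemma linked_addrow_mat:
  assumes "a < sum_list ns" "b < sum_list ns" "block_of ns a < block_of ns b"
  shows "linked ns (addrow_mat (sum_list ns) t a b) (1\<^sub>m (sum_list ns))"
    "linked ns (1\<^sub>m (sum_list ns)) (addrow_mat (sum_list ns) t a b)"
proof -
  have "a \<noteq> b" using assms by auto
  with assms show "linked ns (addrow_mat (sum_list ns) t a b) (1\<^sub>m (sum_list ns))"
    "linked ns (1\<^sub>m (sum_list ns)) (addrow_mat (sum_list ns) t a b)"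
    by (auto simp: linked_def diag_part_addrow_mat block_upper_addrow_mat)
qed

lemma linked_addrow_mat_same_block:
  fixes t :: "'a :: field"
  assumes "a < sum_list ns" "b < sum_list ns" "block_of ns a = block_of ns b" "a \<noteq> b"
  shows "linked ns (addrow_mat (sum_list ns) t a b) (addrow_mat (sum_list ns) (- t) a b)"
  using assms addrow_mat_inv[of a "sum_list ns" b t] addrow_mat_inv[of a "sum_list ns" b "- t"]
  by (auto simp: linked_def diag_part_addrow_mat block_upper_addrow_mat)

lemma linked_multrow_mat:
  fixes t :: "'a :: field"
  assumes "a < sum_list ns" "t \<noteq> 0"
  shows "linked ns (multrow_mat (sum_list ns) a (inverse t)) (multrow_mat (sum_list ns) a t)"
proof -
  have "diag_part ns (multrow_mat (sum_list ns) a s) = multrow_mat (sum_list ns) a s"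
    "block_upper ns (multrow_mat (sum_list ns) a s)" for s :: 'a
    by (auto intro!: eq_matI simp: diag_part_def block_upper_def)
  then show ?thesis
    using assms multrow_mat_inv[of a "sum_list ns" t] multrow_mat_inv[of a "sum_list ns" "inverse t"]
    by (auto simp: linked_def)
qed

lemma parabolic_equivI:
  "x \<in> carrier_mat (sum_list ns) (sum_list ns) \<Longrightarrow> linked ns g h \<Longrightarrow> parabolic_equiv ns x (g * x * h)"
  by (auto simp: parabolic_equiv_iff)

lemma parabolic_equiv_addrow:
  assumes "y \<in> carrier_mat (sum_list ns) (sum_list ns)"
    "a < sum_list ns" "b < sum_list ns" "block_of ns a < block_of ns b"
  shows "parabolic_equiv ns y (addrow t a b y)"
  using parabolic_equivI[OF assms(1) linked_addrow_mat(1)[OF assms(2-4), of t]]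
    addrow_mat[OF assms(1,3), of t a] assms(1) by (simp add: right_mult_one_mat[of _ _ "sum_list ns"])

lemma parabolic_equiv_addcol:
  fixes y :: "'a :: field mat"
  assumes "y \<in> carrier_mat (sum_list ns) (sum_list ns)"
    "a < sum_list ns" "b < sum_list ns" "block_of ns a < block_of ns b"
  shows "parabolic_equiv ns y (addcol t b a y)"
  using parabolic_equivI[OF assms(1) linked_addrow_mat(2)[OF assms(2-4), of t]]
    addcol_mat[OF assms(1,2), of t b] assms(1) by simp

lemma parabolic_equiv_addrow_addcol:
  fixes y :: "'a :: field mat"
  assumes "y \<in> carrier_mat (sum_list ns) (sum_list ns)"
    "a < sum_list ns" "b < sum_list ns" "block_of ns a = block_of ns b" "a \<noteq> b"
  shows "parabolic_equiv ns y (addcol (- t) b a (addrow t a b y))"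
proof -
  have "addrow t a b y \<in> carrier_mat (sum_list ns) (sum_list ns)" using assms(1) by simp
  then show ?thesis
    using parabolic_equivI[OF assms(1) linked_addrow_mat_same_block[OF assms(2-5), of t]]
    by (simp add: addrow_mat[OF assms(1,3)] addcol_mat[OF _ assms(2)])
qed

lemma parabolic_equiv_multrow_multcol:
  fixes y :: "'a :: field mat"
  assumes "y \<in> carrier_mat (sum_list ns) (sum_list ns)" "a < sum_list ns" "t \<noteq> 0"
  shows "parabolic_equiv ns y (multcol a t (multrow a (inverse t) y))"
proof -
  have "multrow a (inverse t) y \<in> carrier_mat (sum_list ns) (sum_list ns)" using assms(1) by simp
  then show ?thesis
    using parabolic_equivI[OF assms(1) linked_multrow_mat[OF assms(2,3)]]
    by (simp add: multrow_mat[OF assms(1)] multcol_mat)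
qed

section \<open>Chains of a rook placement and their words\<close>

text \<open>The predecessor of \<open>j\<close> in its chain; for \<open>D\<inverse>\<close> in
  place of \<open>D\<close> it is the successor.\<close>

definition partner :: "(nat \<times> nat) set \<Rightarrow> nat \<Rightarrow> nat option" where
  "partner D j = (if \<exists>i. (i, j) \<in> D then Some (SOME i. (i, j) \<in> D) else None)"

lemma partner_eq_None: "partner D j = None \<longleftrightarrow> (\<forall>i. (i, j) \<notin> D)"
  by (simp add: partner_def)

lemma partner_eq_Some:
  assumes "\<And>i i' j. (i, j) \<in> D \<Longrightarrow> (i', j) \<in> D \<Longrightarrow> i = i'"
  shows "partner D j = Some i \<longleftrightarrow> (i, j) \<in> D"
  using assms someI[of "\<lambda>i. (i, j) \<in> D"] unfolding partner_def by auto

text \<open>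
  A rook placement is a union of chains. The word of \<open>j\<close> lists the blocks met on walking along its
  chain from \<open>j\<close>, closed by the end marker \<open>e\<close>; the walk is cut off after \<open>m\<close> steps.
\<close>

fun word :: "(nat \<Rightarrow> nat) \<Rightarrow> nat list \<Rightarrow> (nat \<times> nat) set \<Rightarrow> nat \<Rightarrow> nat \<Rightarrow> nat list" where
  "word f e D 0 j = []"
| "word f e D (Suc m) j =
     f j # (case partner D j of None \<Rightarrow> e | Some i \<Rightarrow> word f e D m i)"

lemma rook_placement_partner:
  "rook_placement ns D \<Longrightarrow> partner D j = Some i \<longleftrightarrow> (i, j) \<in> D"
  by (rule partner_eq_Some) (auto simp: rook_placement_def)

lemma rook_placement_root:
  assumes "rook_placement ns D" "(i, j) \<in> D"
  shows "i < sum_list ns" "j < sum_list ns" "block_of ns i < block_of ns j" "i < j"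
  using assms root_less[of i j ns] by (auto simp: rook_placement_def roots_iff subset_iff)

section \<open>Existence: reduction column by column\<close>

definition agrees :: "nat list \<Rightarrow> (nat \<times> nat) set \<Rightarrow> nat \<Rightarrow> 'a :: field mat \<Rightarrow> bool" where
  "agrees ns D j y \<longleftrightarrow>
     (\<forall>i<sum_list ns. \<forall>c<j. y $$ (i, c) = (if (i, c) \<in> D then 1 else 0))"

text \<open>
  Adding row \<open>b\<close> to row \<open>a\<close> of the same block forces a column operation, which spoils the row of
  the predecessor of \<open>a\<close> in the chain by a multiple of the row of the predecessor of \<open>b\<close>. The damage
  can be pushed along the two chains until it disappears, provided that \<open>a\<close> has the smaller word.
\<close>

lemma add_row_along_chains:
  fixes y :: "'a :: field mat"
  assumes D: "rook_placement ns D" and j: "j < sum_list ns"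
    and "y \<in> nil_radical ns" "a < m" "block_of ns a < block_of ns j" "block_of ns b < block_of ns j"
    and "a \<noteq> b" "word (block_of ns) [] D m a \<le> word (block_of ns) [] D m b"
    and "\<And>i c. i < sum_list ns \<Longrightarrow> c < j \<Longrightarrow> y $$ (i, c) =
      (if (i, c) \<in> D then 1 else 0) - (if i = a \<and> (b, c) \<in> D then t else 0)"
    and "\<And>i c. (i, c) \<in> D \<Longrightarrow> y $$ (i, j) = 0"
    and "\<And>c. (a, c) \<in> D \<Longrightarrow> y $$ (b, j) = 0"
  shows "\<exists>y'. parabolic_equiv ns y y' \<and> agrees ns D j y' \<and>
    (\<forall>i<sum_list ns. y' $$ (i, j) = y $$ (i, j) + (if i = a then t * y $$ (b, j) else 0))"
  using assms(3-)
\<comment> \<open>Predecessors have smaller indices, so the bound \<open>a < m\<close> survives the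
  step from \<open>a\<close> to its predecessor and the walk ends before \<open>m\<close> runs
  out.\<close>
proof (induction m arbitrary: a b y)
  case (Suc m)
  let ?n = "sum_list ns"
  have yc: "y \<in> carrier_mat ?n ?n" using Suc.prems(1) by (rule nil_radical_carrier)
  have ab: "a < j" "b < j"
    using Suc.prems(3,4) block_of_mono[of j _ ns] by (meson linorder_not_less)+
  have nab: "a < ?n" "b < ?n" using ab j by auto
  have D_inj: "(i, c) \<in> D \<Longrightarrow> (i', c) \<in> D \<Longrightarrow> i = i'" "(i, c) \<in> D \<Longrightarrow> (i, c') \<in> D \<Longrightarrow> c = c'" for i i' c c'
    using D by (auto simp: rook_placement_def)
  have le: "block_of ns a < block_of ns b \<or> block_of ns a = block_of ns b \<and>
      (case partner D a of None \<Rightarrow> [] | Some i \<Rightarrow> word (block_of ns) [] D m i) \<le>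
      (case partner D b of None \<Rightarrow> [] | Some i \<Rightarrow> word (block_of ns) [] D m i)"
    using Suc.prems(6) by simp
  \<comment> \<open>This repairs the defect of row \<open>a\<close>. Across blocks nothing else
    happens; inside a block the companion column operation must follow.\<close>
  let ?y1 = "addrow t a b y"
  have y1: "?y1 $$ (i, c) = (if (i, c) \<in> D then 1 else 0)" if "i < ?n" "c < j" for i c
  proof -
    have "(if a = b \<and> (b, c) \<in> D then t else 0) = 0" using Suc.prems(5) by simp
    then show ?thesis using that yc nab Suc.prems(5) Suc.prems(7)[of i c] Suc.prems(7)[of b c] j by auto
  qed
  have y1j: "?y1 $$ (i, j) = y $$ (i, j) + (if i = a then t * y $$ (b, j) else 0)" if "i < ?n" for i
    using that yc nab j by auto
  show ?case
  proof (cases "block_of ns a < block_of ns b")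
    case True
    then have "parabolic_equiv ns y ?y1" using parabolic_equiv_addrow[OF yc nab] by simp
    then show ?thesis using y1 y1j unfolding agrees_def by blast
  next
    case False
    with le have eq: "block_of ns a = block_of ns b" by simp
    \<comment> \<open>Subtracting \<open>t\<close> times column \<open>a\<close> from column
      \<open>b\<close> leaves \<open>- t\<close> in the row of the predecessor of \<open>a\<close>:
      a defect of the same form for the two predecessors.\<close>
    let ?y2 = "addcol (- t) b a ?y1"
    have equiv: "parabolic_equiv ns y ?y2"
      by (rule parabolic_equiv_addrow_addcol[OF yc nab eq Suc.prems(5)])
    have y2: "?y2 $$ (i, c) = (if (i, c) \<in> D then 1 else 0) - (if c = b \<and> (i, a) \<in> D then t else 0)"
      if "i < ?n" "c < j" for i c
    proof -
      have "?y2 $$ (i, c) = (if b = c then - t * ?y1 $$ (i, a) + ?y1 $$ (i, c) else ?y1 $$ (i, c))"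
        using that yc j by (subst index_mat_addcol(1)) auto
      then show ?thesis using y1[of i a] y1[of i c] that ab by auto
    qed
    have y2j: "?y2 $$ (i, j) = y $$ (i, j) + (if i = a then t * y $$ (b, j) else 0)" if "i < ?n" for i
    proof -
      have "?y2 $$ (i, j) = ?y1 $$ (i, j)" using that yc j ab by (subst index_mat_addcol(1)) auto
      then show ?thesis using y1j[OF that] by simp
    qed
    show ?thesis
    proof (cases "partner D a")
      \<comment> \<open>Before column \<open>j\<close>, \<open>?y1\<close> is the rook matrix, so
        its column \<open>a\<close> is zero and the column operation has no effect there.\<close>
      case None
      then have "agrees ns D j ?y2" using y2 unfolding agrees_def by (auto simp: partner_eq_None)
      then show ?thesis using equiv y2j by blast
    next
      case (Some a')
      then have a': "(a', a) \<in> D" by (simp add: rook_placement_partner[OF D])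
      note ra = rook_placement_root[OF D a']
      \<comment> \<open>With \<open>m\<close> positive the word of \<open>a'\<close> is nonempty,
        hence not below the end marker \<open>[]\<close>; so the chain of \<open>b\<close> continues
        as well.\<close>
      have "0 < m" using ra(4) Suc.prems(2) by simp
      then obtain b' where b'': "partner D b = Some b'"
        "word (block_of ns) [] D m a' \<le> word (block_of ns) [] D m b'"
        using le eq Some by (cases "partner D b"; cases m) auto
      then have b': "(b', b) \<in> D" by (simp add: rook_placement_partner[OF D])
      note rb = rook_placement_root[OF D b']
      have ne: "a' \<noteq> b'" using a' b' D_inj Suc.prems(5) by blast
      \<comment> \<open>If row \<open>a\<close> carries a root, the entry added to it is zero by the
        last premise. Thus rows with roots stay zero in column \<open>j\<close>, and the recursive
        call, which adds a multiple of row \<open>b'\<close>, leaves column \<open>j\<close>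
        unchanged.\<close>
      have col0: "?y2 $$ (i, j) = 0" if "(i, c) \<in> D" for i c
        using that y2j[OF rook_placement_root(1)[OF D that]] Suc.prems(8,9) by auto
      have "\<exists>y'. parabolic_equiv ns ?y2 y' \<and> agrees ns D j y' \<and>
          (\<forall>i<?n. y' $$ (i, j) = ?y2 $$ (i, j) + (if i = a' then t * ?y2 $$ (b', j) else 0))"
      proof (rule Suc.IH)
        show "?y2 \<in> nil_radical ns" by (rule nil_radical_parabolic_equiv[OF Suc.prems(1) equiv])
        show "?y2 $$ (i, c) = (if (i, c) \<in> D then 1 else 0) - (if i = a' \<and> (b', c) \<in> D then t else 0)"
          if "i < ?n" "c < j" for i c
        proof -
          have "c = b \<and> (i, a) \<in> D \<longleftrightarrow> i = a' \<and> (b', c) \<in> D" using a' b' D_inj by blast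
          then show ?thesis using y2[OF that] by simp
        qed
      qed (use ra rb eq Suc.prems(2,3,4) ne b''(2) col0 b' in auto)
      then obtain y' where "parabolic_equiv ns ?y2 y'" "agrees ns D j y'"
        "\<forall>i<?n. y' $$ (i, j) = ?y2 $$ (i, j)" using col0[OF b'] by auto
      then show ?thesis using parabolic_equiv_trans[OF yc equiv] y2j by metis
    qed
  qed
qed simp

text \<open>For a root \<open>(a, d)\<close> column \<open>d\<close> is a unit vector, so
  subtracting a multiple of it from column \<open>j\<close> changes only the entry in row
  \<open>a\<close>. The roots are treated one after another.\<close>

lemma clear_column_at_rook_rows:
  fixes y :: "'a :: field mat"
  assumes D: "rook_placement ns D" "D \<subseteq> UNIV \<times> {..<j}" and j: "j < sum_list ns"
    and y: "y \<in> nil_radical ns" "agrees ns D j y"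
  shows "\<exists>y'. parabolic_equiv ns y y' \<and> agrees ns D j y' \<and> (\<forall>(i, c)\<in>D. y' $$ (i, j) = 0)"
proof -
  let ?n = "sum_list ns"
  have "finite D" using D(1) by (rule rook_placement_finite)
  have "\<exists>y'. parabolic_equiv ns y y' \<and> agrees ns D j y' \<and> (\<forall>(i, c)\<in>E. y' $$ (i, j) = 0)"
    if "E \<subseteq> D" for E
    using finite_subset[OF that \<open>finite D\<close>] that
  proof (induction E)
    case empty
    then show ?case using y parabolic_equiv_refl[OF nil_radical_carrier[OF y(1)]] by blast
  next
    case (insert e E)
    obtain a d where e: "e = (a, d)" by force
    from insert.IH insert.prems obtain z where z: "parabolic_equiv ns y z" "agrees ns D j z"
      "\<forall>(i, c)\<in>E. z $$ (i, j) = 0" by blast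
    have zE: "z $$ (i, j) = 0" if "(i, c) \<in> E" for i c using z(3) that by blast
    have aD: "(a, d) \<in> D" using insert e by simp
    note ra = rook_placement_root[OF D(1) aD]
    have d: "d < j" using D(2) aD by blast
    have zn: "z \<in> nil_radical ns" by (rule nil_radical_parabolic_equiv[OF y(1) z(1)])
    note zc = nil_radical_carrier[OF zn]
    have inD: "(i, d) \<in> D \<longleftrightarrow> i = a" for i using aD D(1) unfolding rook_placement_def by blast
    let ?t = "- z $$ (a, j)"
    have zd: "z $$ (i, d) = (if i = a then 1 else 0)" if "i < ?n" for i
      using z(2) that d inD[of i] unfolding agrees_def by simp
    have "\<exists>z'. parabolic_equiv ns z z' \<and> (\<forall>i<?n. \<forall>c\<le>j. z' $$ (i, c) =
        z $$ (i, c) + (if c = j then ?t * z $$ (i, d) else 0))"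
    proof (cases "block_of ns d < block_of ns j")
      case True
      have "parabolic_equiv ns z (addcol ?t j d z)"
        by (rule parabolic_equiv_addcol[OF zc ra(2) j True])
      then show ?thesis using zc j by (intro exI[of _ "addcol ?t j d z"]) auto
    next
      \<comment> \<open>Now a multiple of row \<open>j\<close> must be added to row
        \<open>d\<close>. This is invisible up to column \<open>j\<close>, where row
        \<open>j\<close> of an element of J vanishes.\<close>
      case False
      then have eq: "block_of ns d = block_of ns j" using block_of_mono[of d j ns] d by simp
      let ?z' = "addcol ?t j d (addrow (- ?t) d j z)"
      have 1: "parabolic_equiv ns z ?z'"
        using parabolic_equiv_addrow_addcol[OF zc ra(2) j eq, of "- ?t"] d by simp
      have "addrow (- ?t) d j z $$ (i, c) = z $$ (i, c)" if "i < ?n" "c \<le> j" for i c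
        using that zc j nil_radical_zero[OF zn, of j c] block_of_mono[of c j ns] by auto
      moreover have "?z' $$ (i, c) = addrow (- ?t) d j z $$ (i, c) +
          (if c = j then ?t * addrow (- ?t) d j z $$ (i, d) else 0)" if "i < ?n" "c \<le> j" for i c
        using that zc j by (subst index_mat_addcol(1)) auto
      ultimately have "?z' $$ (i, c) = z $$ (i, c) + (if c = j then ?t * z $$ (i, d) else 0)"
        if "i < ?n" "c \<le> j" for i c using that d by simp
      then show ?thesis using 1 by blast
    qed
    then obtain z' where z': "parabolic_equiv ns z z'"
      "\<And>i c. i < ?n \<Longrightarrow> c \<le> j \<Longrightarrow> z' $$ (i, c) = z $$ (i, c) + (if c = j then ?t * z $$ (i, d) else 0)"
      by blast
    have "agrees ns D j z'" using z(2) z'(2) unfolding agrees_def by auto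
    moreover have "z' $$ (i, j) = 0" if "(i, c) \<in> insert e E" for i c
    proof -
      have "i < ?n" using that insert.prems rook_placement_root(1)[OF D(1)] by blast
      with z'(2)[of i j] zd[of i] have "z' $$ (i, j) = (if i = a then 0 else z $$ (i, j))" by simp
      then show ?thesis using zE[of i c] that e by auto
    qed
    ultimately show ?case
      using parabolic_equiv_trans[OF nil_radical_carrier[OF y(1)] z(1) z'(1)] by blast
  qed
  then show ?thesis by blast
qed

text \<open>After the rows with roots are cleared, the remaining nonzero rows are those in
  \<open>F\<close>. One of them becomes the pivot and eliminates the others, and column
  \<open>j\<close> gains at most one root.\<close>

lemma reduce_column:
  fixes y :: "'a :: field mat"
  assumes D: "rook_placement ns D" "D \<subseteq> UNIV \<times> {..<j}" and j: "j < sum_list ns"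
    and y: "y \<in> nil_radical ns" "agrees ns D j y"
  shows "\<exists>y' D'. parabolic_equiv ns y y' \<and> rook_placement ns D' \<and>
    D' \<subseteq> UNIV \<times> {..<Suc j} \<and> agrees ns D' (Suc j) y'"
proof -
  let ?n = "sum_list ns" and ?w = "word (block_of ns) [] D (sum_list ns)"
  obtain z where z: "parabolic_equiv ns y z" "agrees ns D j z" "\<forall>(i, c)\<in>D. z $$ (i, j) = 0"
    using clear_column_at_rook_rows[OF D j y] by blast
  have zD: "z $$ (i, j) = 0" if "(i, c) \<in> D" for i c using z(3) that by blast
  have zn: "z \<in> nil_radical ns" by (rule nil_radical_parabolic_equiv[OF y(1) z(1)])
  note zc = nil_radical_carrier[OF zn]
  define F where "F = {i. i < ?n \<and> z $$ (i, j) \<noteq> 0}"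
  have F: "block_of ns i < block_of ns j" "i < ?n" "\<And>c. (i, c) \<notin> D" if "i \<in> F" for i
    using that nil_radical_zero[OF zn, of i j] j zD unfolding F_def
    by (auto simp: linorder_not_less[symmetric])
  show ?thesis
  proof (cases "F = {}")
    case True
    moreover have "(i, j) \<notin> D" for i using D(2) by auto
    ultimately have "agrees ns D (Suc j) z" using z(2) unfolding agrees_def F_def by (auto simp: less_Suc_eq)
    moreover have "D \<subseteq> UNIV \<times> {..<Suc j}" using D(2) by auto
    ultimately show ?thesis using z(1) D(1) by blast
  next
    case False
    have fin: "finite F" by (simp add: F_def)
    \<comment> \<open>The order on words is lexicographic. A row with the largest word can be added
      to every other row of \<open>F\<close> by \<open>add_row_along_chains\<close>.\<close>
    then have "Max (?w ` F) \<in> ?w ` F" using False by (intro Max_in) auto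
    then obtain p where "p \<in> F" and p: "?w p = Max (?w ` F)" by auto
    then have max: "?w i \<le> ?w p" if "i \<in> F" for i using that fin by simp
    have "\<exists>z'. parabolic_equiv ns z z' \<and> agrees ns D j z' \<and>
        (\<forall>i<?n. z' $$ (i, j) = (if i \<in> E then 0 else z $$ (i, j)))" if "E \<subseteq> F - {p}" for E
      using finite_subset[OF that finite_Diff[OF fin]] that
    proof (induction E)
      case empty
      then show ?case using z(2) parabolic_equiv_refl[OF zc] by auto
    next
      case (insert a E)
      then obtain u where u: "parabolic_equiv ns z u" "agrees ns D j u"
        "\<And>i. i < ?n \<Longrightarrow> u $$ (i, j) = (if i \<in> E then 0 else z $$ (i, j))" by blast
      have un: "u \<in> nil_radical ns" by (rule nil_radical_parabolic_equiv[OF zn u(1)])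
      have a: "a \<in> F" "a \<noteq> p" using insert.prems by auto
      let ?t = "- u $$ (a, j) / u $$ (p, j)"
      have "\<exists>u'. parabolic_equiv ns u u' \<and> agrees ns D j u' \<and>
          (\<forall>i<?n. u' $$ (i, j) = u $$ (i, j) + (if i = a then ?t * u $$ (p, j) else 0))"
      proof (rule add_row_along_chains[OF D(1) j un])
        show "?w a \<le> ?w p" by (rule max[OF a(1)])
        \<comment> \<open>Row \<open>p\<close> carries no root, so the prescribed defect is zero at
          the start.\<close>
        show "u $$ (i, c) = (if (i, c) \<in> D then 1 else 0) - (if i = a \<and> (p, c) \<in> D then ?t else 0)"
          if "i < ?n" "c < j" for i c
          using that u(2) F(3)[OF \<open>p \<in> F\<close>] unfolding agrees_def by simp
        show "u $$ (i, j) = 0" if "(i, c) \<in> D" for i c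
          using that u(3)[OF rook_placement_root(1)[OF D(1) that]] zD by auto
      qed (use a F \<open>p \<in> F\<close> in auto)
      then obtain u' where u': "parabolic_equiv ns u u'" "agrees ns D j u'"
        "\<And>i. i < ?n \<Longrightarrow> u' $$ (i, j) = u $$ (i, j) + (if i = a then ?t * u $$ (p, j) else 0)" by blast
      have "u $$ (p, j) \<noteq> 0" using u(3)[of p] \<open>p \<in> F\<close> insert.prems unfolding F_def by auto
      then have "u' $$ (i, j) = (if i \<in> insert a E then 0 else z $$ (i, j))" if "i < ?n" for i
        using u(3)[OF that] u'(3)[OF that] by auto
      then show ?case using u'(2) parabolic_equiv_trans[OF zc u(1) u'(1)] by blast
    qed
    from this[of "F - {p}"] obtain u where u: "parabolic_equiv ns z u" "agrees ns D j u"
      "\<And>i. i < ?n \<Longrightarrow> u $$ (i, j) = (if i \<in> F - {p} then 0 else z $$ (i, j))" by blast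
    have un: "u \<in> nil_radical ns" by (rule nil_radical_parabolic_equiv[OF zn u(1)])
    note uc = nil_radical_carrier[OF un]
    let ?s = "inverse (z $$ (p, j))"
    have s: "z $$ (p, j) \<noteq> 0" using \<open>p \<in> F\<close> by (simp add: F_def)
    \<comment> \<open>Scaling column \<open>j\<close> makes the pivot 1; the forced scaling of row
      \<open>j\<close> acts on zeros up to column \<open>j\<close>.\<close>
    let ?v = "multcol j ?s (multrow j (inverse ?s) u)"
    have uv: "parabolic_equiv ns u ?v"
      by (rule parabolic_equiv_multrow_multcol[OF uc j]) (use s in simp)
    have row: "multrow j (inverse ?s) u $$ (i, c) = u $$ (i, c)" if "i < ?n" "c \<le> j" for i c
      using that uc j nil_radical_zero[OF un, of j c] block_of_mono[of c j ns] by auto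
    have v: "?v $$ (i, c) = (if c = j then ?s * u $$ (i, c) else u $$ (i, c))"
      if "i < ?n" "c \<le> j" for i c
    proof -
      have "?v $$ (i, c) = (if j = c then ?s * multrow j (inverse ?s) u $$ (i, c)
          else multrow j (inverse ?s) u $$ (i, c))"
        using that uc j by (subst index_mat_multcol(1)) auto
      then show ?thesis using row[OF that] by auto
    qed
    let ?D = "insert (p, j) D"
    have "(i, j) \<notin> D" for i using D(2) by auto
    then have D': "rook_placement ns ?D"
      using D(1) F[OF \<open>p \<in> F\<close>] j unfolding rook_placement_def by (auto simp: roots_iff)
    have "?v $$ (i, j) = (if i = p then 1 else 0)" if "i < ?n" for i
      using v[OF that, of j] u(3)[OF that] s that by (auto simp: F_def)
    then have "agrees ns ?D (Suc j) ?v"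
      using u(2) v \<open>\<And>i. (i, j) \<notin> D\<close> unfolding agrees_def by (auto simp: less_Suc_eq)
    moreover have "parabolic_equiv ns y ?v"
      using parabolic_equiv_trans[OF nil_radical_carrier[OF y(1)] z(1)] parabolic_equiv_trans[OF zc u(1) uv]
      by blast
    moreover have "?D \<subseteq> UNIV \<times> {..<Suc j}" using D(2) by auto
    ultimately show ?thesis using D' by blast
  qed
qed

theorem parabolic_equiv_rook_matrix:
  assumes x: "(x :: 'a :: field mat) \<in> nil_radical ns"
  shows "\<exists>D. rook_placement ns D \<and> parabolic_equiv ns x (rook_matrix ns D)"
proof -
  let ?n = "sum_list ns"
  have "\<exists>y D. parabolic_equiv ns x y \<and> rook_placement ns D \<and>
      D \<subseteq> UNIV \<times> {..<j} \<and> agrees ns D j y" if "j \<le> ?n" for j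
    using that
  proof (induction j)
    case 0
    show ?case
      using parabolic_equiv_refl[OF nil_radical_carrier[OF x]]
      by (intro exI[of _ x] exI[of _ "{}"]) (auto simp: rook_placement_def agrees_def)
  next
    case (Suc j)
    then obtain y D where y: "parabolic_equiv ns x y" "rook_placement ns D"
      "D \<subseteq> UNIV \<times> {..<j}" "agrees ns D j y" by auto
    have "j < ?n" using Suc.prems by simp
    with reduce_column[OF y(2,3) this nil_radical_parabolic_equiv[OF x y(1)] y(4)]
    obtain y' D' where *: "parabolic_equiv ns y y'" "rook_placement ns D'"
      "D' \<subseteq> UNIV \<times> {..<Suc j}" "agrees ns D' (Suc j) y'" by auto
    show ?case
      using parabolic_equiv_trans[OF nil_radical_carrier[OF x] y(1) *(1)] *(2-4) by blast
  qed
  then obtain y D where y: "parabolic_equiv ns x y" "rook_placement ns D" "agrees ns D ?n y" by blast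
  have "y = rook_matrix ns D"
    using nil_radical_carrier[OF nil_radical_parabolic_equiv[OF x y(1)]] y(3)
    by (intro eq_matI) (auto simp: agrees_def rook_matrix_index[OF y(2)])
  then show ?thesis using y by blast
qed

section \<open>Weyl conjugate placements give equivalent matrices\<close>

lemma weyl_group_block_of:
  assumes w: "w \<in> weyl_group ns" and i: "i < sum_list ns"
  shows "w i < sum_list ns" "block_of ns (w i) = block_of ns i"
proof -
  let ?k = "block_of ns i"
  have k: "?k < length ns" using i by (rule block_of_less)
  then have "i \<in> segment ns ?k" using i by (simp add: segment_iff)
  then have "w i \<in> segment ns ?k" using w k by (auto simp: weyl_group_def)
  then show "w i < sum_list ns" "block_of ns (w i) = ?k" using segment_iff[OF k] by auto
qed

text \<open>Conjugation by the permutation matrix of \<open>w\<close>, which is block diagonal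
  because \<open>w\<close> preserves the segments.\<close>

lemma weyl_conjugate_imp_parabolic_equiv:
  assumes D: "rook_placement ns D" "rook_placement ns D'" and "weyl_conjugate ns D D'"
  shows "parabolic_equiv ns (rook_matrix ns D :: 'a :: field mat) (rook_matrix ns D')"
proof -
  let ?n = "sum_list ns" and ?x = "rook_matrix ns D :: 'a mat"
  obtain w where w: "w \<in> weyl_group ns" "D' = (\<lambda>(i, j). (w i, w j)) ` D"
    using assms(3) by (auto simp: weyl_conjugate_def)
  have perm: "w permutes {..<?n}" using w(1) by (simp add: weyl_group_def)
  let ?v = "inv_into UNIV w"
  have v: "?v i < ?n" if "i < ?n" for i
    using permutes_in_image[OF permutes_inv[OF perm], of i] that by simp
  have wv [simp]: "w (?v i) = i" "?v (w i) = i" for i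
    using permutes_inverses[OF perm] by auto
  have w_eq: "i = w j \<longleftrightarrow> j = ?v i" "w j = i \<longleftrightarrow> j = ?v i" for i j by auto
  define g where "g = mat ?n ?n (\<lambda>(i, j). if i = w j then 1 else 0 :: 'a)"
  define h where "h = mat ?n ?n (\<lambda>(i, j). if w i = j then 1 else 0 :: 'a)"
  have c: "g \<in> carrier_mat ?n ?n" "h \<in> carrier_mat ?n ?n" by (auto simp: g_def h_def)
  have gA: "(g * A) $$ (i, j) = A $$ (?v i, j)" if "A \<in> carrier_mat ?n ?n" "i < ?n" "j < ?n" for A i j
  proof -
    have "(g * A) $$ (i, j) = (\<Sum>l<?n. if l = ?v i then A $$ (l, j) else 0)"
      unfolding index_mult_square[OF c(1) that] using that
      by (intro sum.cong) (auto simp: g_def)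
    then show ?thesis using v that by simp
  qed
  have Ah: "(A * h) $$ (i, j) = A $$ (i, ?v j)" if "A \<in> carrier_mat ?n ?n" "i < ?n" "j < ?n" for A i j
  proof -
    have "(A * h) $$ (i, j) = (\<Sum>l<?n. if l = ?v j then A $$ (i, l) else 0)"
      unfolding index_mult_square[OF that(1) c(2) that(2,3)] using that
      by (intro sum.cong) (auto simp: h_def)
    then show ?thesis using v that by simp
  qed
  have gh: "g * h = 1\<^sub>m ?n" "h * g = 1\<^sub>m ?n"
  proof -
    show "g * h = 1\<^sub>m ?n"
    proof (rule eq_matI)
      fix i j assume "i < dim_row (1\<^sub>m ?n :: 'a mat)" "j < dim_col (1\<^sub>m ?n :: 'a mat)"
      then show "(g * h) $$ (i, j) = 1\<^sub>m ?n $$ (i, j)" using gA[OF c(2), of i j] v by (simp add: h_def)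
    qed (use c in auto)
    then show "h * g = 1\<^sub>m ?n" by (rule mat_mult_left_right_inverse[OF c])
  qed
  have blk: "block_of ns (w j) = block_of ns j" if "j < ?n" for j
    using weyl_group_block_of[OF w(1) that] by simp
  have dp: "diag_part ns g = g" "diag_part ns h = h"
    using blk by (auto intro!: eq_matI simp: diag_part_def g_def h_def)
  have "linked ns g h"
    unfolding linked_def using block_upper_diag_part[of ns g] block_upper_diag_part[of ns h] gh
    unfolding dp by simp
  then have "parabolic_equiv ns ?x (g * ?x * h)" by (rule parabolic_equivI[OF rook_matrix_carrier])
  also have "g * ?x * h = rook_matrix ns D'"
  proof (rule eq_matI)
    fix i j assume "i < dim_row (rook_matrix ns D' :: 'a mat)" "j < dim_col (rook_matrix ns D' :: 'a mat)"
    then have ij: "i < ?n" "j < ?n" by auto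
    have "(g * ?x * h) $$ (i, j) = ?x $$ (?v i, ?v j)"
      using Ah[of "g * ?x" i j] gA[of ?x i "?v j"] ij v c
      by (simp del: index_mult_mat(1) assoc_mult_mat)
    also have "\<dots> = (if (?v i, ?v j) \<in> D then 1 else 0)" using ij v by (simp add: rook_matrix_index[OF D(1)])
    also have "(?v i, ?v j) \<in> D \<longleftrightarrow> (i, j) \<in> D'" unfolding w(2) by force
    finally show "(g * ?x * h) $$ (i, j) = rook_matrix ns D' $$ (i, j)"
      using ij by (simp add: rook_matrix_index[OF D(2)])
  qed (use c in auto)
  finally show ?thesis .
qed

section \<open>Intertwiners of two rook matrices\<close>

text \<open>The end marker \<open>length ns\<close> exceeds all blocks, so that along forward walks the longer chain is the smaller one.\<close>

abbreviation backward_word :: "nat list \<Rightarrow> (nat \<times> nat) set \<Rightarrow> nat \<Rightarrow> nat \<Rightarrow> nat list" where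
  "backward_word ns D \<equiv> word (block_of ns) [] D"

abbreviation forward_word :: "nat list \<Rightarrow> (nat \<times> nat) set \<Rightarrow> nat \<Rightarrow> nat \<Rightarrow> nat list" where
  "forward_word ns D \<equiv> word (block_of ns) [length ns] (D\<inverse>)"

lemma rook_placement_partner_converse:
  "rook_placement ns D \<Longrightarrow> partner (D\<inverse>) i = Some j \<longleftrightarrow> (i, j) \<in> D"
  by (subst partner_eq_Some) (auto simp: rook_placement_def)

text \<open>A rook matrix on the right shifts the columns of \<open>g\<close> along
  \<open>D\<close>, one on the left shifts the rows of \<open>k\<close> along \<open>D'\<close>.
  Thus a nonzero entry is carried along two chains at once.\<close>

lemma intertwiner_entries:
  assumes D: "rook_placement ns D" "rook_placement ns D'"
    and g: "g \<in> carrier_mat (sum_list ns) (sum_list ns)"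
    and k: "k \<in> carrier_mat (sum_list ns) (sum_list ns)"
    and eq: "g * rook_matrix ns D = rook_matrix ns D' * k"
    and ij: "i < sum_list ns" "j < sum_list ns"
  shows "(case partner D j of None \<Rightarrow> 0 | Some b \<Rightarrow> g $$ (i, b)) =
    (case partner (D'\<inverse>) i of None \<Rightarrow> 0 | Some c \<Rightarrow> k $$ (c, j))"
proof -
  let ?n = "sum_list ns"
  have "(g * rook_matrix ns D) $$ (i, j) = (\<Sum>l<?n. g $$ (i, l) * (if (l, j) \<in> D then 1 else 0))"
    unfolding index_mult_square[OF g rook_matrix_carrier ij]
    by (intro sum.cong) (auto simp: rook_matrix_index[OF D(1) _ ij(2)])
  also have "\<dots> = (case partner D j of None \<Rightarrow> 0 | Some b \<Rightarrow> g $$ (i, b))"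
  proof (cases "partner D j")
    case (Some b)
    then have b: "(b, j) \<in> D" by (simp add: rook_placement_partner[OF D(1)])
    then have "(l, j) \<in> D \<longleftrightarrow> l = b" for l using D(1) unfolding rook_placement_def by blast
    then have "(\<Sum>l<?n. g $$ (i, l) * (if (l, j) \<in> D then 1 else 0)) =
        (\<Sum>l<?n. if l = b then g $$ (i, l) else 0)" by (intro sum.cong) auto
    then show ?thesis using Some rook_placement_root(1)[OF D(1) b] by simp
  next
    case None
    then have "(l, j) \<notin> D" for l by (simp add: partner_eq_None)
    with None show ?thesis by simp
  qed
  finally have 1: "(g * rook_matrix ns D) $$ (i, j) =
    (case partner D j of None \<Rightarrow> 0 | Some b \<Rightarrow> g $$ (i, b))" .
  have "(rook_matrix ns D' * k) $$ (i, j) = (\<Sum>l<?n. (if (i, l) \<in> D' then 1 else 0) * k $$ (l, j))"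
    unfolding index_mult_square[OF rook_matrix_carrier k ij]
    by (intro sum.cong) (auto simp: rook_matrix_index[OF D(2) ij(1)])
  also have "\<dots> = (case partner (D'\<inverse>) i of None \<Rightarrow> 0 | Some c \<Rightarrow> k $$ (c, j))"
  proof (cases "partner (D'\<inverse>) i")
    case (Some c)
    then have c: "(i, c) \<in> D'" by (simp add: rook_placement_partner_converse[OF D(2)])
    then have "(i, l) \<in> D' \<longleftrightarrow> l = c" for l using D(2) unfolding rook_placement_def by blast
    then have "(\<Sum>l<?n. (if (i, l) \<in> D' then 1 else 0) * k $$ (l, j)) =
        (\<Sum>l<?n. if l = c then k $$ (l, j) else 0)" by (intro sum.cong) auto
    then show ?thesis using Some rook_placement_root(2)[OF D(2) c] by simp
  next
    case None
    then have "(i, l) \<notin> D'" for l by (simp add: partner_eq_None)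
    with None show ?thesis by simp
  qed
  finally show ?thesis using 1 unfolding eq by simp
qed

text \<open>A nonzero entry at \<open>(i, j)\<close> forces one at the neighbours in the two chains.
  Block triangularity bounds the block of the one neighbour by that of the other: a strict
  inequality decides the comparison of words, equality continues the induction.\<close>

lemma intertwiner_words_le:
  assumes D: "rook_placement ns D" "rook_placement ns D'"
    and bu: "block_upper ns g" "block_upper ns k" and dp: "diag_part ns k = diag_part ns g"
    and eq: "g * rook_matrix ns D = rook_matrix ns D' * k"
    and "i < sum_list ns" "j < sum_list ns" "block_of ns i = block_of ns j" "g $$ (i, j) \<noteq> 0"
  shows "backward_word ns D' m i \<le> backward_word ns D m j"
    and "forward_word ns D' m i \<le> forward_word ns D m j"
proof -
  let ?n = "sum_list ns"
  note ent = intertwiner_entries[OF D block_upper_carrier[OF bu(1)] block_upper_carrier[OF bu(2)] eq]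
  \<comment> \<open>Equality of the diagonal blocks allows passing between \<open>g\<close> and
    \<open>k\<close>, so that the walk can go on.\<close>
  have gk: "k $$ (i, j) = g $$ (i, j)" if "i < ?n" "j < ?n" "block_of ns i = block_of ns j" for i j
    using arg_cong[OF dp, of "\<lambda>A. A $$ (i, j)"] that by simp
  have less_word: "word (block_of ns) e E m a \<le> word (block_of ns) e E' m b"
    if "block_of ns a < block_of ns b" for e E E' m a b
    using that by (cases m) auto
  show "backward_word ns D' m i \<le> backward_word ns D m j"
    using assms(7-10)
  proof (induction m arbitrary: i j)
    case (Suc m)
    show ?case
    proof (cases "partner D' i")
      case (Some a)
      then have a: "(a, i) \<in> D'" by (simp add: rook_placement_partner[OF D(2)])
      note ra = rook_placement_root[OF D(2) a]
      have "partner (D'\<inverse>) a = Some i" using a by (simp add: rook_placement_partner_converse[OF D(2)])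
      \<comment> \<open>The entries at \<open>(a, j)\<close> are compared: one side is the nonzero
        \<open>k $$ (i, j)\<close>, so \<open>j\<close> has a predecessor too.\<close>
      then have "(case partner D j of None \<Rightarrow> 0 | Some b \<Rightarrow> g $$ (a, b)) \<noteq> 0"
        using ent[OF ra(1) Suc.prems(2)] gk[OF Suc.prems(1-3)] Suc.prems(4) by simp
      then obtain b where b: "partner D j = Some b" "g $$ (a, b) \<noteq> 0" by (cases "partner D j") auto
      then have "(b, j) \<in> D" by (simp add: rook_placement_partner[OF D(1)])
      note rb = rook_placement_root[OF D(1) this]
      have "block_of ns a \<le> block_of ns b"
        using bu(1) b(2) ra(1) rb(1) unfolding block_upper_def by (meson linorder_not_less)
      then have "backward_word ns D' m a \<le> backward_word ns D m b"
        using less_word[of a b] Suc.IH[OF ra(1) rb(1) _ b(2)]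
        by (cases "block_of ns a = block_of ns b") auto
      then show ?thesis using Some b(1) Suc.prems(3) by simp
    qed (use Suc.prems in auto)
  qed simp
  show "forward_word ns D' m i \<le> forward_word ns D m j"
    using assms(7-10)
  proof (induction m arbitrary: i j)
    case (Suc m)
    show ?case
    proof (cases "partner (D\<inverse>) j")
      case None
      show ?thesis
      proof (cases "partner (D'\<inverse>) i")
        case (Some i')
        then have "(i, i') \<in> D'" by (simp add: rook_placement_partner_converse[OF D(2)])
        then have "block_of ns i' < length ns" using rook_placement_root[OF D(2)] block_of_less by blast
        \<comment> \<open>The first letter is a block number, hence smaller than the end
          marker.\<close>
        then have "forward_word ns D' m i' \<le> [length ns]" by (cases m) auto
        then show ?thesis using None Some Suc.prems(3) by simp
      qed (use None Suc.prems in simp)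
    next
      case (Some j')
      then have j': "(j, j') \<in> D" by (simp add: rook_placement_partner_converse[OF D(1)])
      note rj = rook_placement_root[OF D(1) j']
      have "partner D j' = Some j" using j' by (simp add: rook_placement_partner[OF D(1)])
      then have "(case partner (D'\<inverse>) i of None \<Rightarrow> 0 | Some c \<Rightarrow> k $$ (c, j')) \<noteq> 0"
        using ent[OF Suc.prems(1) rj(2)] Suc.prems(4) by simp
      then obtain i' where i': "partner (D'\<inverse>) i = Some i'" "k $$ (i', j') \<noteq> 0"
        by (cases "partner (D'\<inverse>) i") auto
      then have "(i, i') \<in> D'" by (simp add: rook_placement_partner_converse[OF D(2)])
      note ri = rook_placement_root[OF D(2) this]
      have "block_of ns i' \<le> block_of ns j'"
        using bu(2) i'(2) ri(2) rj(2) unfolding block_upper_def by (meson linorder_not_less)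
      then have "forward_word ns D' m i' \<le> forward_word ns D m j'"
        using less_word[of i' j'] Suc.IH[OF ri(2) rj(2)] gk[OF ri(2) rj(2)] i'(2)
        by (cases "block_of ns i' = block_of ns j'") auto
      then show ?thesis using Some i'(1) Suc.prems(3) by simp
    qed
  qed simp
qed

section \<open>Counting positions of equal chain type\<close>

text \<open>Keeping the truncations for all \<open>m\<close> records the complete words without a
  bound on the length of chains.\<close>

definition chain_type :: "nat list \<Rightarrow> (nat \<times> nat) set \<Rightarrow> nat \<Rightarrow> (nat \<Rightarrow> nat list) \<times> (nat \<Rightarrow> nat list)" where
  "chain_type ns D i = ((\<lambda>m. backward_word ns D m i), (\<lambda>m. forward_word ns D m i))"

text \<open>Since \<open>p\<close> is a left inverse of \<open>q\<close>, multiplication by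
  \<open>q\<close> is injective from vectors indexed by \<open>T\<close> to vectors indexed by
  \<open>S\<close>. Over a finite field, counting vectors compares the dimensions.\<close>

lemma card_le_if_left_inverse:
  fixes p q :: "'b \<Rightarrow> 'b \<Rightarrow> 'a :: {field, finite}"
  assumes fin: "finite S" "finite T"
    and inv: "\<And>i j. i \<in> T \<Longrightarrow> j \<in> T \<Longrightarrow> (\<Sum>l\<in>S. p i l * q l j) = (if i = j then 1 else 0)"
  shows "card T \<le> card S"
proof -
  let ?f = "\<lambda>v. restrict (\<lambda>l. \<Sum>j\<in>T. q l j * v j) S"
  have rec: "v i = (\<Sum>l\<in>S. p i l * ?f v l)" if "i \<in> T" for v i
  proof -
    have "(\<Sum>l\<in>S. p i l * ?f v l) = (\<Sum>l\<in>S. \<Sum>j\<in>T. p i l * q l j * v j)"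
      by (intro sum.cong) (auto simp: sum_distrib_left mult.assoc)
    also have "\<dots> = (\<Sum>j\<in>T. (\<Sum>l\<in>S. p i l * q l j) * v j)"
      by (subst sum.swap) (simp add: sum_distrib_right)
    also have "\<dots> = (\<Sum>j\<in>T. if i = j then v j else 0)"
      using that by (intro sum.cong) (auto simp: inv)
    finally show ?thesis using that fin by simp
  qed
  have "inj_on ?f (T \<rightarrow>\<^sub>E UNIV)"
  proof (rule inj_onI)
    fix v w assume vw: "v \<in> T \<rightarrow>\<^sub>E UNIV" "w \<in> T \<rightarrow>\<^sub>E UNIV" "?f v = ?f w"
    show "v = w"
    proof (rule PiE_ext[OF vw(1,2)])
      fix i assume i: "i \<in> T"
      have "v i = (\<Sum>l\<in>S. p i l * ?f v l)" by (rule rec[OF i])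
      also have "\<dots> = (\<Sum>l\<in>S. p i l * ?f w l)" by (simp only: vw(3))
      also have "\<dots> = w i" by (rule rec[OF i, symmetric])
      finally show "v i = w i" .
    qed
  qed
  then have "card (T \<rightarrow>\<^sub>E (UNIV :: 'a set)) \<le> card (S \<rightarrow>\<^sub>E (UNIV :: 'a set))"
    by (rule card_inj_on_le) (use fin in \<open>auto intro!: finite_PiE\<close>)
  then have "card (UNIV :: 'a set) ^ card T \<le> card (UNIV :: 'a set) ^ card S"
    using fin by (simp add: card_PiE)
  moreover have "card {0, 1 :: 'a} \<le> card (UNIV :: 'a set)" by (rule card_mono) auto
  then have "1 < card (UNIV :: 'a set)" by simp
  ultimately show ?thesis by (rule power_le_imp_le_exp[rotated])
qed

text \<open>An index \<open>l\<close> that contributes to the entry \<open>(i, j)\<close> of the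
  product has words between those of \<open>i\<close> and \<open>j\<close>. These have the same type
  \<open>c\<close>, so \<open>l\<close> has it too, and the submatrices on positions of type
  \<open>c\<close> still multiply to the identity.\<close>

lemma chain_type_count_le:
  fixes g k k' g' :: "'a :: {field, finite} mat"
  assumes D: "rook_placement ns D" "rook_placement ns D'"
    and bu: "block_upper ns g" "block_upper ns k" "diag_part ns k = diag_part ns g"
      "g * rook_matrix ns D = rook_matrix ns D' * k"
    and bu': "block_upper ns g'" "block_upper ns k'" "diag_part ns k' = diag_part ns g'"
      "g' * rook_matrix ns D' = rook_matrix ns D * k'"
    and one: "diag_part ns g * diag_part ns g' = 1\<^sub>m (sum_list ns)"
  shows "card {i. i < sum_list ns \<and> chain_type ns D' i = c} \<le>
    card {i. i < sum_list ns \<and> chain_type ns D i = c}" (is "card ?T \<le> card ?S")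
proof (rule card_le_if_left_inverse)
  let ?n = "sum_list ns"
  fix i j assume ij: "i \<in> ?T" "j \<in> ?T"
  let ?a = "\<lambda>l. diag_part ns g $$ (i, l) * diag_part ns g' $$ (l, j)"
  have "?a l = 0" if "l < ?n" "l \<notin> ?S" for l
  proof (rule ccontr)
    assume "?a l \<noteq> 0"
    then have *: "block_of ns i = block_of ns l" "block_of ns l = block_of ns j"
        "g $$ (i, l) \<noteq> 0" "g' $$ (l, j) \<noteq> 0"
      using that ij by (auto split: if_splits)
    have "backward_word ns D' m i \<le> backward_word ns D m l" "forward_word ns D' m i \<le> forward_word ns D m l"
      "backward_word ns D m l \<le> backward_word ns D' m j" "forward_word ns D m l \<le> forward_word ns D' m j" for m
      using intertwiner_words_le[OF D bu, of i l m] intertwiner_words_le[OF D(2,1) bu', of l j m] * that ij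
      by auto
    moreover have "backward_word ns D' m i = backward_word ns D' m j \<and> forward_word ns D' m i = forward_word ns D' m j" for m
      using ij by (auto simp: chain_type_def fun_eq_iff)
    ultimately have "backward_word ns D m l = backward_word ns D' m i \<and> forward_word ns D m l = forward_word ns D' m i" for m
      by (metis order.antisym)
    then have "chain_type ns D l = chain_type ns D' i" by (simp add: chain_type_def)
    then show False using that ij by auto
  qed
  then have "(\<Sum>l\<in>?S. ?a l) = (\<Sum>l<?n. ?a l)" by (intro sum.mono_neutral_left) auto
  also have "\<dots> = (diag_part ns g * diag_part ns g') $$ (i, j)"
    by (rule index_mult_square[symmetric]) (use ij in auto)
  also have "\<dots> = (if i = j then 1 else 0)" unfolding one using ij by simp
  finally show "(\<Sum>l\<in>?S. ?a l) = (if i = j then 1 else 0)" .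
qed auto

text \<open>Cancelling \<open>h\<close> in \<open>x' = g * x * h\<close> gives the intertwiner
  \<open>(g, k)\<close> from \<open>D\<close> to \<open>D'\<close>, cancelling \<open>g\<close>
  gives \<open>(m, h)\<close> in the other direction. Each yields one inequality.\<close>

lemma parabolic_equiv_imp_chain_type_count:
  fixes ns :: "nat list" and D D' :: "(nat \<times> nat) set"
  assumes D: "rook_placement ns D" "rook_placement ns D'"
    and "parabolic_equiv ns (rook_matrix ns D :: 'a :: {field, finite} mat) (rook_matrix ns D')"
  shows "card {i. i < sum_list ns \<and> chain_type ns D i = c} =
    card {i. i < sum_list ns \<and> chain_type ns D' i = c}"
proof -
  let ?n = "sum_list ns" and ?x = "rook_matrix ns D :: 'a mat" and ?x' = "rook_matrix ns D' :: 'a mat"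
  obtain g h where gh: "linked ns g h" "?x' = g * ?x * h"
    using assms(3) by (auto simp: parabolic_equiv_iff)
  note c = linked_carrier[OF gh(1)]
  obtain k where k: "block_upper ns k" "diag_part ns k = diag_part ns g" "h * k = 1\<^sub>m ?n"
    using linked_inverse[OF gh(1)] by blast
  obtain m where m: "block_upper ns m" "diag_part ns m = diag_part ns h" "m * g = 1\<^sub>m ?n"
    using linked_inverse[OF linked_sym[OF gh(1)]] by blast
  note ck = block_upper_carrier[OF k(1)] and cm = block_upper_carrier[OF m(1)]
  have "?x' * k = g * ?x * (h * k)"
    unfolding gh(2) using c ck by (intro assoc_mult_mat[of _ ?n ?n _ ?n _ ?n]) auto
  then have 1: "g * ?x = ?x' * k" unfolding k(3) using c by (simp add: right_mult_one_mat[of _ ?n ?n])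
  have "m * ?x' = m * (g * (?x * h))"
    unfolding gh(2) using c by (subst assoc_mult_mat[of g ?n ?n ?x ?n h ?n]) auto
  also have "\<dots> = m * g * (?x * h)"
    using c cm by (intro assoc_mult_mat[symmetric, of _ ?n ?n _ ?n _ ?n]) auto
  finally have 2: "m * ?x' = ?x * h" unfolding m(3) using c by (simp add: left_mult_one_mat[of _ ?n ?n])
  have bu: "block_upper ns g" "block_upper ns h" and
    dp: "diag_part ns g * diag_part ns m = 1\<^sub>m ?n" "diag_part ns m * diag_part ns g = 1\<^sub>m ?n"
    using gh(1) m(2) by (auto simp: linked_def)
  show ?thesis
    using chain_type_count_le[OF D bu(1) k(1,2) 1 m(1) bu(2) m(2)[symmetric] 2 dp(1), of c]
      chain_type_count_le[OF D(2,1) m(1) bu(2) m(2)[symmetric] 2 bu(1) k(1,2) 1 dp(2), of c]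
    by simp
qed

section \<open>From equal counts to a Weyl group element\<close>

lemma bij_betw_fibres:
  assumes fin: "finite S" and card: "\<And>c. card {i \<in> S. t i = c} = card {i \<in> S. t' i = c}"
  shows "\<exists>f. bij_betw f S S \<and> (\<forall>i\<in>S. t' (f i) = t i)"
proof -
  have "\<exists>h. bij_betw h {i \<in> S. t i = c} {i \<in> S. t' i = c}" for c
    using fin card by (intro finite_same_card_bij) auto
  then have "\<forall>c. \<exists>h. bij_betw h {i \<in> S. t i = c} {i \<in> S. t' i = c}" by blast
  from choice[OF this] obtain h where h: "\<And>c. bij_betw (h c) {i \<in> S. t i = c} {i \<in> S. t' i = c}" by blast
  let ?f = "\<lambda>i. h (t i) i"
  have f: "?f i \<in> S" "t' (?f i) = t i" if "i \<in> S" for i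
    using bij_betwE[OF h[of "t i"]] that by auto
  have "inj_on ?f S"
  proof (rule inj_onI)
    fix i j assume ij: "i \<in> S" "j \<in> S" "?f i = ?f j"
    then have "t i = t j" using f(2)[OF ij(1)] f(2)[OF ij(2)] by simp
    then show "i = j"
      using inj_onD[OF bij_betw_imp_inj_on[OF h[of "t j"]], of i j] ij by simp
  qed
  moreover have "?f ` S \<subseteq> S" using f by auto
  ultimately have "bij_betw ?f S S" using endo_inj_surj[OF fin] by (simp add: bij_betw_def)
  then show ?thesis using f(2) by (intro exI[of _ ?f]) simp
qed

text \<open>The graph of the desired permutation. A type-preserving bijection \<open>f\<close> need
  not map roots to roots, so it is used only where chains start; from there the matching follows
  both chains in parallel.\<close>

inductive matched :: "nat \<Rightarrow> (nat \<times> nat) set \<Rightarrow> (nat \<times> nat) set \<Rightarrow> (nat \<Rightarrow> nat) \<Rightarrow> nat \<Rightarrow> nat \<Rightarrow> bool"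
  for n D D' f where
  start: "i < n \<Longrightarrow> \<forall>p. (p, i) \<notin> D \<Longrightarrow> matched n D D' f i (f i)"
| step: "matched n D D' f i i' \<Longrightarrow> (i, j) \<in> D \<Longrightarrow> (i', j') \<in> D' \<Longrightarrow> matched n D D' f j j'"

lemma chain_type_predecessor:
  assumes "rook_placement ns D" "rook_placement ns D'" "chain_type ns D' i' = chain_type ns D i"
    "\<forall>p. (p, i) \<notin> D"
  shows "(p, i') \<notin> D'"
proof
  assume "(p, i') \<in> D'"
  then have "partner D' i' = Some p" "partner D i = None"
    using assms by (simp_all add: rook_placement_partner partner_eq_None)
  \<comment> \<open>Two is the first cut-off at which the word shows whether a predecessor
    exists.\<close>
  moreover have "backward_word ns D' (Suc (Suc 0)) i' = backward_word ns D (Suc (Suc 0)) i"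
    using assms(3) unfolding chain_type_def prod.inject fun_eq_iff by (elim conjE allE)
  ultimately show False by simp
qed

text \<open>The end marker \<open>length ns\<close> is not the block number of any valid index, so
  the second letter shows whether the chain continues.\<close>

lemma forward_word_successor:
  assumes D: "rook_placement ns D" "rook_placement ns D'"
    and w: "\<And>m. forward_word ns D m i = forward_word ns D' m i'" and j: "(i, j) \<in> D"
  shows "\<exists>j'. (i', j') \<in> D'"
proof (rule ccontr)
  assume "\<nexists>j'. (i', j') \<in> D'"
  then have "partner (D'\<inverse>) i' = None" "partner (D\<inverse>) i = Some j"
    using j by (simp_all add: rook_placement_partner_converse[OF D(1)] partner_eq_None)
  with w[of "Suc (Suc 0)"] have "block_of ns j = length ns" by (simp split: option.splits)
  then show False using block_of_less rook_placement_root(2)[OF D(1) j] by fastforce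
qed

lemma chain_type_count_imp_weyl_conjugate:
  assumes D: "rook_placement ns D" "rook_placement ns D'"
    and card: "\<And>c. card {i. i < sum_list ns \<and> chain_type ns D i = c} =
      card {i. i < sum_list ns \<and> chain_type ns D' i = c}"
  shows "weyl_conjugate ns D D'"
proof -
  let ?n = "sum_list ns"
  obtain f where f: "bij_betw f {..<?n} {..<?n}" "\<And>i. i < ?n \<Longrightarrow> chain_type ns D' (f i) = chain_type ns D i"
    using bij_betw_fibres[of "{..<?n}" "chain_type ns D" "chain_type ns D'"] card by auto
  let ?m = "matched ?n D D' f"
  have D_inj: "(i, c) \<in> D \<Longrightarrow> (i', c) \<in> D \<Longrightarrow> i = i'" "(i, c) \<in> D \<Longrightarrow> (i, c') \<in> D \<Longrightarrow> c = c'"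
    "(i, c) \<in> D' \<Longrightarrow> (i', c) \<in> D' \<Longrightarrow> i = i'" "(i, c) \<in> D' \<Longrightarrow> (i, c') \<in> D' \<Longrightarrow> c = c'" for i i' c c'
    using D unfolding rook_placement_def by blast+
  \<comment> \<open>Backward words enter here: \<open>f\<close> sends starts of chains to starts of
    chains.\<close>
  have fstart: "(p, f i) \<notin> D'" if "i < ?n" "\<forall>p. (p, i) \<notin> D" for i p
    using chain_type_predecessor[OF D f(2)] that by blast
  have bounds: "i < ?n \<and> i' < ?n" if "?m i i'" for i i'
    using that
  proof induction
    case (start i)
    then show ?case using bij_betwE[OF f(1)] by auto
  next
    case (step i i' j j')
    then show ?case
      using rook_placement_root(2)[OF D(1) step(2)] rook_placement_root(2)[OF D(2) step(3)] by simp
  qed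
  \<comment> \<open>Passing to the successor drops the first letter, so equality of forward words is
    inherited along the chains.\<close>
  have words: "forward_word ns D m i = forward_word ns D' m i'" if "?m i i'" for m i i'
    using that
  proof (induction arbitrary: m)
    case (start i)
    then show ?case using f(2)[OF start(1)] by (simp add: chain_type_def fun_eq_iff)
  next
    case (step i i' j j')
    have "partner (D\<inverse>) i = Some j" "partner (D'\<inverse>) i' = Some j'"
      using step by (simp_all add: rook_placement_partner_converse[OF D(1)] rook_placement_partner_converse[OF D(2)])
    then show ?case using step.IH[of "Suc m"] by simp
  qed
  have succ: "\<exists>j'. (i', j') \<in> D'" if "?m i i'" "(i, j) \<in> D" for i i' j
    using forward_word_successor[OF D words[OF that(1)] that(2)] .
  have succ': "\<exists>j. (i, j) \<in> D" if "?m i i'" "(i', j') \<in> D'" for i i' j'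
    using forward_word_successor[OF D(2,1) words[OF that(1), symmetric] that(2)] .
  have ex: "\<exists>i'. ?m i i'" if "i < ?n" for i
    using that
  proof (induction i rule: less_induct)
    case (less i)
    show ?case
    proof (cases "\<exists>p. (p, i) \<in> D")
      case True
      then obtain p where p: "(p, i) \<in> D" by blast
      then obtain p' where "?m p p'" using less rook_placement_root[OF D(1) p] by blast
      then show ?thesis using succ p matched.step by blast
    qed (use less.prems matched.start in blast)
  qed
  have unique: "i' = i''" if "?m i i'" "?m i i''" for i i' i''
    using that
  proof (induction arbitrary: i'')
    case (start i)
    from start.prems show ?case
    proof cases
      case (step a b)
      then show ?thesis using start.hyps(2) by blast
    qed simp
  next
    case (step i i' j j')
    from step.prems show ?case
    proof cases
      case (step a b)
      then have "a = i" using D_inj(1) \<open>(i, j) \<in> D\<close> by blast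
      then have "b = i'" using step.IH \<open>?m a b\<close> by blast
      then show ?thesis using D_inj(4) step \<open>(i', j') \<in> D'\<close> by blast
    next
      case start
      then show ?thesis using \<open>(i, j) \<in> D\<close> by blast
    qed
  qed
  \<comment> \<open>Two starts are separated by the injectivity of \<open>f\<close>, two later
    positions by induction; a start and a later position cannot meet by
    \<open>fstart\<close>.\<close>
  have inj: "i = j" if "?m i k" "?m j k" for i j k
    using that
  proof (induction arbitrary: j)
    case (start i)
    from start.prems show ?case
    proof cases
      case start
      then show ?thesis
        using inj_onD[OF bij_betw_imp_inj_on[OF f(1)], of i j] \<open>i < ?n\<close> by simp
    next
      case (step a b)
      then show ?thesis using fstart start by blast
    qed
  next
    case (step i i' j0 j')
    from step.prems show ?case
    proof cases
      case start
      then show ?thesis using fstart step by blast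
    next
      case (step a b)
      then have "b = i'" using D_inj(3) \<open>(i', j') \<in> D'\<close> by blast
      then have "i = a" using step.IH \<open>?m a b\<close> by blast
      then show ?thesis using D_inj(2) step \<open>(i, j0) \<in> D\<close> by blast
    qed
  qed
  \<comment> \<open>Outside the index range \<open>w\<close> is the identity, as
    \<open>permutes\<close> demands.\<close>
  define w where "w = (\<lambda>i. if i < ?n then (THE i'. ?m i i') else i)"
  have w: "?m i (w i)" if "i < ?n" for i
    unfolding w_def using that ex[OF that] unique by (auto intro: theI2)
  have w_less: "w i < ?n" if "i < ?n" for i using bounds[OF w[OF that]] by simp
  have w_inj: "inj_on w {..<?n}"
    using inj[OF w] w by (intro inj_onI) (metis lessThan_iff)
  have "w ` {..<?n} = {..<?n}"
    using w_less by (intro endo_inj_surj w_inj) auto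
  then have "w permutes {..<?n}"
    using w_inj by (intro bij_imp_permutes) (auto simp: bij_betw_def w_def)
  moreover have "w ` segment ns k = segment ns k" if k: "k < length ns" for k
  proof (rule endo_inj_surj)
    show "finite (segment ns k)" by (simp add: segment_def)
    show "w ` segment ns k \<subseteq> segment ns k"
      \<comment> \<open>A forward word cut off after one letter is just the block number.\<close>
      using w_less words[OF w, of _ "Suc 0"] by (auto simp: segment_iff[OF k])
    show "inj_on w (segment ns k)"
      using w_inj by (rule inj_on_subset) (auto simp: segment_iff[OF k])
  qed
  ultimately have "w \<in> weyl_group ns" by (simp add: weyl_group_def)
  moreover have "(w i, w j) \<in> D'" if ij: "(i, j) \<in> D" for i j
  proof -
    note r = rook_placement_root[OF D(1) ij]
    obtain j' where j': "(w i, j') \<in> D'" using succ[OF w[OF r(1)] ij] by blast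
    then have "?m j j'" using matched.step[OF w[OF r(1)] ij] by blast
    then show ?thesis using unique[OF w[OF r(2)]] j' by simp
  qed
  moreover have "\<exists>i j. (i, j) \<in> D \<and> w i = i' \<and> w j = j'" if ij: "(i', j') \<in> D'" for i' j'
  proof -
    have "i' \<in> w ` {..<?n}"
      using \<open>w ` {..<?n} = {..<?n}\<close> rook_placement_root(1)[OF D(2) ij] by simp
    then obtain i where i: "i < ?n" "w i = i'" by auto
    then obtain j where j: "(i, j) \<in> D" using succ'[OF w[OF i(1)]] ij by auto
    then have "?m j j'" using matched.step[OF w[OF i(1)] j] ij i(2) by blast
    then have "w j = j'" using unique[OF w] rook_placement_root(2)[OF D(1) j] by blast
    then show ?thesis using i j by blast
  qed
  ultimately have "D' = (\<lambda>(i, j). (w i, w j)) ` D" by fast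
  with \<open>w \<in> weyl_group ns\<close> show ?thesis unfolding weyl_conjugate_def by blast
qed

theorem theorem4p4:
  fixes ns :: "nat list"
  assumes "ns \<noteq> []" and "\<forall>m \<in> set ns. 1 \<le> m \<and> m \<le> 2"
  shows
    "(\<forall>x \<in> (nil_radical ns :: 'a :: {field, finite} mat set).
        \<exists>D. rook_placement ns D \<and> parabolic_equiv ns x (rook_matrix ns D)) \<and>
     (\<forall>D D'. rook_placement ns D \<longrightarrow> rook_placement ns D' \<longrightarrow>
        (parabolic_equiv ns (rook_matrix ns D :: 'a mat) (rook_matrix ns D')
           \<longleftrightarrow> weyl_conjugate ns D D'))"
proof (intro conjI ballI allI impI iffI)
  fix x :: "'a mat" assume "x \<in> nil_radical ns"
  then show "\<exists>D. rook_placement ns D \<and> parabolic_equiv ns x (rook_matrix ns D)"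
    by (rule parabolic_equiv_rook_matrix)
next
  fix D D' assume D: "rook_placement ns D" "rook_placement ns D'"
  {
    assume "parabolic_equiv ns (rook_matrix ns D :: 'a mat) (rook_matrix ns D')"
    from chain_type_count_imp_weyl_conjugate[OF D parabolic_equiv_imp_chain_type_count[OF D this]]
    show "weyl_conjugate ns D D'" .
  next
    assume "weyl_conjugate ns D D'"
    then show "parabolic_equiv ns (rook_matrix ns D :: 'a mat) (rook_matrix ns D')"
      by (rule weyl_conjugate_imp_parabolic_equiv[OF D])
  }
qed

end
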